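(* Suppose the two assumptions (A1) and (A2) in the context hold for each $\mathbf R_l$, $1\le l\le p$. The marginal likelihood and the profile likelihood have the following tail rates. (i) If there is some $l$, $1\le l\le p$, such that $\gamma_l\to0$, then (the limits of) the marginal likelihood and the profile likelihood both exist and are greater than zero. (ii) If $\gamma_l\to\infty$ for all $1\le l\le p$, the marginal likelihood satisfies $$L(\boldsymbol\gamma\mid\mathbf y)=\begin{cases}O\left(\left(\sum_{l=1}^p\nu_l(\gamma_l)\right)^{a-1/2}\right),&\mathbf 1_n\notin\mathcal C(\mathbf H),\\[1mm] O\left(\left(\sum_{l=1}^p\nu_l(\gamma_l)\right)^{a-1}\right),&\mathbf 1_n\in\mathcal C(\mathbf H),\end{cases}$$ and the profile likelihood satisfies $$L(\boldsymbol\gamma\mid\mathbf y,\hat\sigma^2_{MLE},\hat{\boldsymbol\theta}_{MLE})=O\left(\left(\sum_{l=1}^p\nu_l(\gamma_l)\right)^{1/2}\right).$$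
   Context: Setup. $\mathbf x_1,\dots,\mathbf x_n\in\mathbb R^p$ are the design inputs, $\mathbf x_i=(x_{i1},\dots,x_{ip})^T$. $\mathbf H$ is the $n\times q$ matrix of mean basis functions, with $(i,j)$ entry $h_j(\mathbf x_i)$, of full column rank, $n>q$; $\mathcal C(\mathbf H)$ is its column space; $\mathbf 1_n$ is the vector of ones. The outputs follow the model $\mathbf y\sim N(\mathbf H\boldsymbol\theta,\sigma^2\mathbf R)$; $\mathbf y$ denotes the observed realization, and statements are understood for almost every realization. $\mathbf R=\mathbf R_1\circ\cdots\circ\mathbf R_p$ (Hadamard product), where $\mathbf R_l=\mathbf R_l(\gamma_l)$ is the correlation matrix with $(i,j)$ entry $c_l(|x_{il}-x_{jl}|)$ and range parameter $\gamma_l>0$; $\mathbf R$ is positive definite. (A1) For any $d_l\ge0$ and $1\le l\le p$, $c_l(d_l)=c_l^0(d_l/\gamma_l)$, where $c_l^0$ is a correlation function with $\lim_{u\to\infty}c_l^0(u)=0$. (A2) For any $1\le l\le p$, as $\gamma_l\to\infty$, $$\mathbf R_l(\gamma_l)=\mathbf 1_n\mathbf 1_n^T+\nu_l(\gamma_l)\mathbf D_l+\nu_l(\gamma_l)\omega_l(\gamma_l)(\mathbf D_l^*+\mathbf B_l(\gamma_l)),$$ where $\mathbf D_l$ is a nonsingular symmetric matrix with $\mathbf 1_n^T\mathbf D_l^{-1}\mathbf 1_n\ne0$, $\mathbf D_l^*$ is a fixed matrix, $\nu_l(\gamma_l)>0$ is a non-increasing differentiable function, $\omega_l$ is a differentiable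 function, and $\mathbf B_l$ is a differentiable matrix function, satisfying $$\nu_l(\gamma_l)\to0,\quad\omega_l(\gamma_l)\to0,\quad\frac{\omega_l'(\gamma_l)}{\frac{\partial}{\partial\gamma_l}\log\nu_l(\gamma_l)}\to0,\quad\|\mathbf B_l(\gamma_l)\|_\infty\to0,\quad\frac{\left\|\frac{\partial}{\partial\gamma_l}\mathbf B_l(\gamma_l)\right\|_\infty}{\frac{\partial}{\partial\gamma_l}\log(\omega_l(\gamma_l))}\to0,$$ with $\|\mathbf B\|_\infty=\max_{i,j}|b_{ij}|$ the largest absolute entry. Marginal likelihood, for a fixed $a>0$ (prior $\propto(\sigma^2)^{-a}$ on $(\boldsymbol\theta,\sigma^2)$ integrated out): $$L(\boldsymbol\gamma\mid\mathbf y)\propto|\mathbf R|^{-1/2}\,|\mathbf H^T\mathbf R^{-1}\mathbf H|^{-1/2}\,(S^2)^{-\left(\frac{n-q}2+a-1\right)},\quad S^2=\mathbf y^T\mathbf Q\mathbf y,\quad \mathbf Q=\mathbf R^{-1}-\mathbf R^{-1}\mathbf H(\mathbf H^T\mathbf R^{-1}\mathbf H)^{-1}\mathbf H^T\mathbf R^{-1}.$$ Profile likelihood (likelihood with $\boldsymbol\theta,\sigma^2$ replaced by their MLEs given $\boldsymbol\gamma$): $L(\boldsymbol\gamma\mid\mathbf y,\hat\sigma^2_{MLE},\hat{\boldsymbol\theta}_{MLE})\propto|\mathbf R|^{-1/2}(S^2)^{-n/2}$.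
   Formalization: In (ii), when 1_n is not in C(H) and n = q+1, the profile rate is not claimed, and the marginal rate is claimed only for a ≤ 1/2; the printed claims fail in the excluded cases because S^2 stays bounded there. *)

theory Defs
  imports "HOL-Analysis.Analysis" "HOL-Library.Landau_Symbols"
begin

section \<open>Matrices\<close>

definition ones :: "real ^ 'n" where
  "ones = (\<chi> i. 1)"

definition ones_mat :: "real ^ 'n ^ 'n" where
  "ones_mat = (\<chi> i j. ones $ i * ones $ j)"

definition column_space :: "real ^ 'q ^ 'n \<Rightarrow> (real ^ 'n) set" where
  "column_space A = span (columns A)"

definition max_abs_entry :: "real ^ 'm ^ 'n \<Rightarrow> real" where
  "max_abs_entry A = Max {\<bar>A $ i $ j\<bar> | i j. True}"

definition pos_def :: "real ^ 'n ^ 'n \<Rightarrow> bool" where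
  "pos_def A \<longleftrightarrow> transpose A = A \<and> (\<forall>v. v \<noteq> 0 \<longrightarrow> 0 < v \<bullet> (A *v v))"


section \<open>The Gaussian law of the outputs\<close>

definition mvn_density :: "real ^ 'n \<Rightarrow> real ^ 'n ^ 'n \<Rightarrow> real ^ 'n \<Rightarrow> real" where
  "mvn_density \<mu> \<Sigma> y =
     exp (- ((y - \<mu>) \<bullet> (matrix_inv \<Sigma> *v (y - \<mu>))) / 2) / sqrt ((2 * pi) ^ CARD('n) * det \<Sigma>)"

definition mvn :: "real ^ 'n \<Rightarrow> real ^ 'n ^ 'n \<Rightarrow> (real ^ 'n) measure" where
  "mvn \<mu> \<Sigma> = density lborel (\<lambda>y. ennreal (mvn_density \<mu> \<Sigma> y))"


section \<open>Design, mean basis and correlation matrices\<close>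

text \<open>The inputs are collected in \<open>x\<close>, with \<open>x $ i\<close> the \<open>i\<close>-th input and \<open>x $ i $ l\<close> its \<open>l\<close>-th
  coordinate. \<open>c l g d\<close> is the correlation in coordinate \<open>l\<close> at distance \<open>d \<ge> 0\<close> when the range
  parameter is \<open>g > 0\<close>.\<close>

definition basis_mat :: "('q \<Rightarrow> real ^ 'p \<Rightarrow> real) \<Rightarrow> real ^ 'p ^ 'n \<Rightarrow> real ^ 'q ^ 'n" where
  "basis_mat h x = (\<chi> i j. h j (x $ i))"

definition corr_mat ::
    "('p \<Rightarrow> real \<Rightarrow> real \<Rightarrow> real) \<Rightarrow> real ^ 'p ^ 'n \<Rightarrow> 'p \<Rightarrow> real \<Rightarrow> real ^ 'n ^ 'n" where
  "corr_mat c x l g = (\<chi> i j. c l g \<bar>x $ i $ l - x $ j $ l\<bar>)"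

definition prod_corr_mat ::
    "('p \<Rightarrow> real \<Rightarrow> real \<Rightarrow> real) \<Rightarrow> real ^ 'p ^ 'n \<Rightarrow> real ^ 'p \<Rightarrow> real ^ 'n ^ 'n" where
  "prod_corr_mat c x \<gamma> = (\<chi> i j. \<Prod>l\<in>UNIV. corr_mat c x l (\<gamma> $ l) $ i $ j)"

definition pos_params :: "(real ^ 'p) set" where
  "pos_params = {\<gamma>. \<forall>l. 0 < \<gamma> $ l}"


section \<open>Assumptions on the correlation functions\<close>

text \<open>A correlation function of the distance on the real line: normalised at \<open>0\<close>, and
  \<open>(s, t) \<mapsto> f \<bar>s - t\<bar>\<close> is a positive semidefinite kernel (a valid covariance).\<close>

definition correlation_function :: "(real \<Rightarrow> real) \<Rightarrow> bool" where
  "correlation_function f \<longleftrightarrow> f 0 = 1 \<and>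
     (\<forall>T w. finite T \<longrightarrow> 0 \<le> (\<Sum>s\<in>T. \<Sum>t\<in>T. w s * w t * f \<bar>s - t\<bar>))"

definition assumption_A1 :: "(real \<Rightarrow> real \<Rightarrow> real) \<Rightarrow> bool" where
  "assumption_A1 cl \<longleftrightarrow>
     (\<exists>c0. correlation_function c0 \<and> (c0 \<longlongrightarrow> 0) at_top \<and>
           (\<forall>g>0. \<forall>d\<ge>0. cl g d = c0 (d / g)))"

text \<open>The last line of conditions is only meaningful where the denominators do not vanish and
  \<open>\<omega>\<close> has a logarithm. This is not required separately: with total division and logarithm
  (\<open>x / 0 = 0\<close>, \<open>ln 0 = 0\<close>, \<open>ln (- x) = ln x\<close>) the predicate agrees with the intended one where
  everything is defined, and is weaker (so theorems assuming it are stronger) elsewhere.\<close>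

definition assumption_A2 ::
    "(real \<Rightarrow> real ^ 'n ^ 'n) \<Rightarrow> (real \<Rightarrow> real) \<Rightarrow> real ^ 'n ^ 'n \<Rightarrow>
     (real \<Rightarrow> real) \<Rightarrow> real ^ 'n ^ 'n \<Rightarrow> (real \<Rightarrow> real ^ 'n ^ 'n) \<Rightarrow> bool" where
  "assumption_A2 Rl \<nu> D \<omega> Dstar B \<longleftrightarrow>
     (\<forall>\<^sub>F g in at_top. Rl g = ones_mat + \<nu> g *\<^sub>R D + (\<nu> g * \<omega> g) *\<^sub>R (Dstar + B g)) \<and>
     transpose D = D \<and> invertible D \<and> ones \<bullet> (matrix_inv D *v ones) \<noteq> 0 \<and>
     (\<forall>g>0. 0 < \<nu> g) \<and> antimono_on {0<..} \<nu> \<and>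
     (\<forall>g>0. \<nu> differentiable (at g)) \<and>
     (\<forall>g>0. \<omega> differentiable (at g)) \<and>
     (\<forall>g>0. B differentiable (at g)) \<and>
     (\<nu> \<longlongrightarrow> 0) at_top \<and> (\<omega> \<longlongrightarrow> 0) at_top \<and>
     ((\<lambda>g. max_abs_entry (B g)) \<longlongrightarrow> 0) at_top \<and>
     ((\<lambda>g. deriv \<omega> g / deriv (\<lambda>t. ln (\<nu> t)) g) \<longlongrightarrow> 0) at_top \<and>
     ((\<lambda>g. max_abs_entry (vector_derivative B (at g)) / deriv (\<lambda>t. ln (\<omega> t)) g) \<longlongrightarrow> 0) at_top"


section \<open>Likelihoods\<close>

definition Q_mat :: "real ^ 'n ^ 'n \<Rightarrow> real ^ 'q ^ 'n \<Rightarrow> real ^ 'n ^ 'n" where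
  "Q_mat R H = matrix_inv R -
     matrix_inv R ** H ** matrix_inv (transpose H ** matrix_inv R ** H) ** transpose H ** matrix_inv R"

definition S2 :: "real ^ 'n ^ 'n \<Rightarrow> real ^ 'q ^ 'n \<Rightarrow> real ^ 'n \<Rightarrow> real" where
  "S2 R H y = y \<bullet> (Q_mat R H *v y)"

text \<open>Both likelihoods are given only up to a positive factor that does not depend on the range
  parameters (it may depend on the data): the two kernels below fix the dependence on \<open>R\<close>, and
  \<open>proportional_on\<close> expresses the proportionality.\<close>

definition marginal_kernel ::
    "real \<Rightarrow> real ^ 'n ^ 'n \<Rightarrow> real ^ 'q ^ 'n \<Rightarrow> real ^ 'n \<Rightarrow> real" where
  "marginal_kernel a R H y =
     det R powr (- 1 / 2) * det (transpose H ** matrix_inv R ** H) powr (- 1 / 2) *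
     S2 R H y powr (- ((real CARD('n) - real CARD('q)) / 2 + a - 1))"

definition profile_kernel :: "real ^ 'n ^ 'n \<Rightarrow> real ^ 'q ^ 'n \<Rightarrow> real ^ 'n \<Rightarrow> real" where
  "profile_kernel R H y = det R powr (- 1 / 2) * S2 R H y powr (- real CARD('n) / 2)"

definition proportional_on :: "'a set \<Rightarrow> ('a \<Rightarrow> real) \<Rightarrow> ('a \<Rightarrow> real) \<Rightarrow> bool" where
  "proportional_on S f g \<longleftrightarrow> (\<exists>k>0. \<forall>s\<in>S. f s = k * g s)"


section \<open>Limits in the range parameters\<close>

text \<open>The \<open>l\<close>-th range parameter tends to \<open>0\<close>; the others are positive and otherwise arbitrary
  (they may vary, and need not converge).\<close>

definition one_param_to_zero :: "'p \<Rightarrow> (real ^ 'p) filter" where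
  "one_param_to_zero l = inf (filtercomap (\<lambda>\<gamma>. \<gamma> $ l) (at_right 0)) (principal pos_params)"

text \<open>All range parameters tend to infinity, with no relation between their rates.\<close>

definition all_params_to_infinity :: "(real ^ 'p) filter" where
  "all_params_to_infinity = (INF l. filtercomap (\<lambda>\<gamma>. \<gamma> $ l) at_top)"

end

theory Submission
  imports Defs
begin

text \<open>Both kernels are continuous in the correlation matrix \<open>R\<close>, so the first claim is a statement about
  the limit of \<open>R\<close>. If two inputs shared their \<open>l\<close>-th coordinate, two rows of every \<open>R\<^sub>l\<close>, and hence of
  \<open>D\<^sub>l\<close>, would coincide; as \<open>D\<^sub>l\<close> is nonsingular, the coordinates are distinct. Thus \<open>\<gamma>\<^sub>l \<rightarrow> 0\<close> sends every
  off-diagonal entry of \<open>R\<^sub>l\<close> to \<open>0\<close>, and since all entries of the other factors are at most \<open>1\<close> in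
  absolute value, \<open>R\<close> tends to the identity (\<open>prod_corr_mat_tendsto_identity\<close>), where both kernels
  are positive as soon as \<open>y\<close> lies outside the column space of \<open>H\<close>
  (\<open>likelihood_kernels_tendsto_pos\<close>).

  For the second claim put \<open>s = \<Sum>\<^sub>l \<nu>\<^sub>l(\<gamma>\<^sub>l)\<close>, let \<open>1\<close> be the vector of ones and let \<open>b\<close> be its
  normalisation. Multiplying out the Hadamard product gives \<open>R = 1 1\<^sup>T + \<Sum>\<^sub>l \<nu>\<^sub>l D\<^sub>l + o(s)\<close>. The matrices
  \<open>R\<^sub>l\<close> are positive semidefinite, hence so is \<open>D\<^sub>l\<close> on the contrasts, the vectors orthogonal to \<open>1\<close>;
  nonsingularity and \<open>1\<^sup>T D\<^sub>l\<^sup>-\<^sup>1 1 \<noteq> 0\<close> make it positive definite there. So all quadratic forms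
  \<open>\<Sum>\<^sub>l (\<nu>\<^sub>l / s) D\<^sub>l\<close> are bounded below on the contrasts by one positive constant, however the rates of
  the \<open>\<gamma>\<^sub>l\<close> compare, and \<open>R\<close> is comparable, up to constants, with \<open>b b\<^sup>T + s I\<close>
  (\<open>prod_corr_mat_eventually_spiked\<close>). The predicate \<open>spiked\<close> records this comparison, and the
  asymptotics follow from it alone:
  \<^item> \<open>det R\<close> is at least of order \<open>s\<^sup>n\<^sup>-\<^sup>1\<close>, there being one eigenvalue of order \<open>1\<close> and \<open>n - 1\<close> of
    order \<open>s\<close> (\<open>spiked_det_lower\<close>);
  \<^item> \<open>det (H\<^sup>T R\<^sup>-\<^sup>1 H)\<close> is at least of order \<open>s\<^sup>-\<^sup>q\<close>, or \<open>s\<^sup>-\<^sup>(\<^sup>q\<^sup>-\<^sup>1\<^sup>)\<close> if \<open>1\<close> is in the column space, because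
    \<open>R\<^sup>-\<^sup>1\<close> is of order \<open>1 / s\<close> in all directions but \<open>b\<close>, where it is of order \<open>1\<close>
    (\<open>spiked_gram_det_lower\<close>, \<open>spiked_gram_det_lower_spike_in_range\<close>);
  \<^item> \<open>S\<^sup>2\<close> is at most of order \<open>1 / s\<close>, and at least of that order if \<open>y\<close> is not in the span of \<open>1\<close> and
    the columns of \<open>H\<close> (\<open>spiked_S2_upper\<close>, \<open>spiked_S2_lower\<close>). When the dimensions make this span a
    proper subspace, almost every \<open>y\<close> avoids it.

  Multiplying the three bounds gives the stated powers of \<open>s\<close>. If \<open>1\<close> is not in the column space and
  \<open>n = q + 1\<close>, the span of \<open>1\<close> and the columns of \<open>H\<close> is the whole space; the marginal rate then rests
  on \<open>a \<le> 1 / 2\<close>, which makes the exponent of \<open>S\<^sup>2\<close> nonnegative, so that only its upper bound enters.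
  The proofs of the determinant bounds use no eigenvalues: they all come from the fact that a matrix
  that does not shrink any vector has a determinant of absolute value at least \<open>1\<close>.\<close>

section \<open>Determinants bounded below by quadratic forms\<close>

lemma invertible_if_injective:
  fixes K :: "real^'n^'n"
  assumes "\<And>v. K *v v = 0 \<Longrightarrow> v = 0"
  shows "invertible K"
  using assms invertible_left_inverse matrix_left_invertible_ker by blast

lemma abs_det_le_fact_if_entries_le_1:
  fixes M :: "real^'n^'n"
  assumes "\<And>i j. \<bar>M $ i $ j\<bar> \<le> 1"
  shows "\<bar>det M\<bar> \<le> fact CARD('n)"
proof -
  let ?P = "{p. p permutes (UNIV :: 'n set)}"
  have "\<bar>det M\<bar> \<le> (\<Sum>p\<in>?P. \<bar>of_int (sign p) * (\<Prod>i\<in>UNIV. M $ i $ p i)\<bar>)"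
    unfolding det_def by (rule sum_abs)
  also have "\<dots> \<le> (\<Sum>p\<in>?P. 1)"
  proof (rule sum_mono)
    fix p
    have "\<bar>\<Prod>i\<in>UNIV. M $ i $ p i\<bar> \<le> 1"
      unfolding abs_prod by (rule prod_le_1) (use assms in auto)
    then show "\<bar>of_int (sign p) * (\<Prod>i\<in>UNIV. M $ i $ p i)\<bar> \<le> 1"
      by (simp add: abs_mult sign_def)
  qed
  also have "\<dots> = fact CARD('n)" by (simp add: card_permutations)
  finally show ?thesis .
qed

text \<open>All powers of a nonexpanding matrix have entries bounded by \<open>1\<close>, so the Leibniz formula bounds the
  determinants of all of them by the same number; the powers of \<open>det M\<close> can only stay bounded if
  \<open>\<bar>det M\<bar> \<le> 1\<close>.\<close>

lemma abs_det_le_1_if_nonexpanding: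
  fixes M :: "real^'n^'n"
  assumes M: "\<And>v. norm (M *v v) \<le> norm v"
  shows "\<bar>det M\<bar> \<le> 1"
proof (rule ccontr)
  define P where "P k = ((**) M ^^ k) (mat 1)" for k
  have P: "norm (P k *v v) \<le> norm v" for k v
    by (induction k) (auto simp: P_def matrix_vector_mul_assoc[symmetric] intro: order_trans[OF M])
  have "\<bar>P k $ i $ j\<bar> \<le> 1" for k i j
  proof -
    have "P k $ i $ j = (P k *v axis j 1) $ i"
      by (simp add: matrix_vector_mult_basis column_def)
    then show ?thesis
      using component_le_norm_cart[of "P k *v axis j 1" i] P[of k "axis j 1"] by simp
  qed
  then have "\<bar>det (P k)\<bar> \<le> fact CARD('n)" for k by (rule abs_det_le_fact_if_entries_le_1)
  moreover have "det (P k) = det M ^ k" for k by (induction k) (auto simp: P_def det_mul)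
  ultimately have bound: "\<bar>det M\<bar> ^ k \<le> fact CARD('n)" for k by (simp add: power_abs)
  assume "\<not> \<bar>det M\<bar> \<le> 1"
  then obtain k where "fact CARD('n) < \<bar>det M\<bar> ^ k" using real_arch_pow[of "\<bar>det M\<bar>"] by auto
  then show False using bound[of k] by linarith
qed

lemma abs_det_ge_1_if_expanding:
  fixes K :: "real^'n^'n"
  assumes "\<And>v. norm v \<le> norm (K *v v)"
  shows "1 \<le> \<bar>det K\<bar>"
proof -
  have inv: "invertible K"
    by (rule invertible_if_injective) (metis assms norm_le_zero_iff norm_zero)
  then obtain K' where K': "K ** K' = mat 1" by (auto simp: invertible_def)
  have "norm (K' *v v) \<le> norm v" for v
    using assms[of "K' *v v"] by (simp add: matrix_vector_mul_assoc K')
  then have "\<bar>det K'\<bar> \<le> 1" by (rule abs_det_le_1_if_nonexpanding)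
  moreover have "\<bar>det K\<bar> * \<bar>det K'\<bar> = 1" by (metis K' abs_mult abs_one det_I det_mul)
  ultimately show ?thesis by (metis abs_ge_zero mult_left_le)
qed

lemma tendsto_det:
  fixes A :: "'a \<Rightarrow> real^'n^'n"
  assumes "(A \<longlongrightarrow> A0) F"
  shows "((\<lambda>t. det (A t)) \<longlongrightarrow> det A0) F"
  unfolding det_def by (intro tendsto_intros assms)

text \<open>The matrices on the segment from the identity to \<open>A\<close> are all invertible, so the determinant, being
  \<open>1\<close> at the identity, cannot change sign along it.\<close>

lemma det_pos_if_quadratic_form_pos:
  fixes A :: "real^'n^'n"
  assumes "\<And>v. v \<noteq> 0 \<Longrightarrow> 0 < v \<bullet> (A *v v)"
  shows "0 < det A"
proof (rule ccontr)
  define p where "p t = det (t *\<^sub>R A + (1 - t) *\<^sub>R mat 1)" for t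
  assume "\<not> 0 < det A"
  then have "p 1 \<le> 0" by (simp add: p_def)
  moreover have "0 \<le> p 0" by (simp add: p_def)
  moreover have "isCont p t" for t
    unfolding isCont_def p_def by (intro tendsto_det tendsto_intros)
  ultimately obtain t where t: "0 \<le> t" "t \<le> 1" "p t = 0"
    using IVT2[of p 1 0 0] by auto
  let ?M = "t *\<^sub>R A + (1 - t) *\<^sub>R mat 1"
  have "invertible ?M"
  proof (rule invertible_if_injective, rule ccontr)
    fix v assume 0: "?M *v v = 0" and v: "v \<noteq> 0"
    have "v \<bullet> (?M *v v) = t * (v \<bullet> (A *v v)) + (1 - t) * (v \<bullet> v)"
      by (simp add: matrix_vector_mult_add_rdistrib inner_add_right flip: scaleR_matrix_vector_assoc)
    moreover have "0 < t * (v \<bullet> (A *v v)) + (1 - t) * (v \<bullet> v)"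
      using t assms[OF v] v
      by (cases "t = 0") (auto intro!: add_pos_nonneg mult_pos_pos)
    ultimately show False using 0 by simp
  qed
  then show False using t(3) by (simp add: invertible_det_nz p_def)
qed

text \<open>After rescaling the coordinates to make all \<open>d i\<close> equal to \<open>1\<close>, the Cauchy-Schwarz inequality shows
  that the matrix does not shrink any vector. This takes the place of the monotonicity of
  eigenvalues.\<close>

lemma det_ge_prod_if_quadratic_form_ge:
  fixes A :: "real^'n^'n" and d :: "'n \<Rightarrow> real"
  assumes d: "\<And>i. 0 < d i" and A: "\<And>v. (\<Sum>i\<in>UNIV. d i * (v $ i)\<^sup>2) \<le> v \<bullet> (A *v v)"
  shows "(\<Prod>i\<in>UNIV. d i) \<le> det A"
proof -
  \<comment> \<open>the congruence with this diagonal matrix turns the lower bound into the squared norm\<close>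
  define S :: "real^'n^'n" where "S = (\<chi> i j. if i = j then 1 / sqrt (d i) else 0)"
  have S: "(S *v v) $ i = v $ i / sqrt (d i)" for v i
    by (simp add: S_def matrix_vector_mult_def if_distrib if_distribR cong: if_cong)
  have tS: "transpose S = S" by (auto simp: S_def transpose_def vec_eq_iff)
  define K where "K = S ** A ** S"
  have quad: "v \<bullet> v \<le> v \<bullet> (K *v v)" for v
  proof -
    have "v \<bullet> v = (\<Sum>i\<in>UNIV. d i * ((S *v v) $ i)\<^sup>2)"
      using d by (simp add: inner_vec_def S power_divide power2_eq_square[symmetric] less_imp_le
          order_less_imp_not_eq2)
    also have "\<dots> \<le> (S *v v) \<bullet> (A *v (S *v v))" by (rule A)
    also have "\<dots> = v \<bullet> (K *v v)"
      by (metis K_def tS dot_lmul_matrix matrix_vector_mul_assoc transpose_matrix_vector)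
    finally show ?thesis .
  qed
  have "norm v \<le> norm (K *v v)" for v
  proof (cases "v = 0")
    case False
    have "norm v * norm v \<le> norm v * norm (K *v v)"
      using quad[of v] norm_cauchy_schwarz[of v "K *v v"] by (simp add: dot_square_norm power2_eq_square)
    then show ?thesis using False by simp
  qed simp
  then have "1 \<le> \<bar>det K\<bar>" by (rule abs_det_ge_1_if_expanding)
  moreover have "det K = det A / (\<Prod>i\<in>UNIV. d i)"
  proof -
    have "det S = (\<Prod>i\<in>UNIV. 1 / sqrt (d i))"
      by (subst det_diagonal) (auto simp: S_def)
    then have "det S * det S = (\<Prod>i\<in>UNIV. 1 / d i)"
      using d by (simp add: less_imp_le flip: prod.distrib)
    then show ?thesis by (simp add: K_def det_mul prod_dividef mult.commute mult.left_commute)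
  qed
  moreover have "0 < det A"
  proof (rule det_pos_if_quadratic_form_pos)
    fix v :: "real^'n" assume "v \<noteq> 0"
    then obtain i where "v $ i \<noteq> 0" by (auto simp: vec_eq_iff)
    then have "0 < (\<Sum>i\<in>UNIV. d i * (v $ i)\<^sup>2)"
      using d by (intro sum_pos2[of _ i]) (auto simp: less_imp_le)
    then show "0 < v \<bullet> (A *v v)" using A[of v] by linarith
  qed
  moreover have "0 < (\<Prod>i\<in>UNIV. d i)" by (rule prod_pos) (use d in auto)
  ultimately show ?thesis by (simp add: field_simps abs_if)
qed

text \<open>A rotation carries \<open>b\<close> to a coordinate axis, where the lower bound becomes diagonal with one
  entry \<open>\<alpha>\<close> and all others \<open>\<beta>\<close>.\<close>

lemma det_ge_if_quadratic_form_ge_along_direction: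
  fixes A :: "real^'n^'n"
  assumes "norm b = 1" "0 < \<alpha>" "0 < \<beta>"
    and A: "\<And>v. \<alpha> * (b \<bullet> v)\<^sup>2 + \<beta> * (norm (v - (b \<bullet> v) *\<^sub>R b))\<^sup>2 \<le> v \<bullet> (A *v v)"
  shows "\<alpha> * \<beta> ^ (CARD('n) - 1) \<le> det A"
proof -
  obtain k :: 'n where True by simp
  have "norm (axis k 1 :: real^'n) = norm b"
    using assms(1) by simp
  then obtain f where f: "orthogonal_transformation f" and fk: "f (axis k 1 :: real^'n) = b"
    by (rule orthogonal_transformation_exists)
  define U where "U = matrix f"
  have U: "orthogonal_matrix U" using f by (simp add: U_def orthogonal_transformation_matrix)
  have fU: "f v = U *v v" for v
    using f by (simp add: U_def orthogonal_transformation_linear matrix_works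
        orthogonal_transformation_def)
  have fi: "f v \<bullet> f w = v \<bullet> w" for v w using f by (simp add: orthogonal_transformation_def)
  have lf: "linear f" using f by (simp add: orthogonal_transformation_def)
  define d where "d i = (if i = k then \<alpha> else \<beta>)" for i
  have "(\<Prod>i\<in>UNIV. d i) \<le> det (transpose U ** A ** U)"
  proof (rule det_ge_prod_if_quadratic_form_ge)
    show "0 < d i" for i using assms by (simp add: d_def)
    fix v :: "real^'n"
    have bv: "b \<bullet> f v = v $ k" by (metis fk fi inner_axis' inner_real_def mult_1)
    have nf: "norm (f w) = norm w" for w by (simp add: norm_eq_sqrt_inner fi)
    have "f v - (b \<bullet> f v) *\<^sub>R b = f (v - (v $ k) *\<^sub>R axis k 1)"
      unfolding bv by (simp add: linear_diff[OF lf] linear_cmul[OF lf] fk)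
    then have "(norm (f v - (b \<bullet> f v) *\<^sub>R b))\<^sup>2 = (norm (v - (v $ k) *\<^sub>R axis k 1))\<^sup>2"
      using nf by metis
    also have "\<dots> = (\<Sum>i\<in>UNIV. if i = k then 0 else (v $ i)\<^sup>2)"
      unfolding norm_vec_def L2_set_def
      by (subst real_sqrt_pow2) (auto intro!: sum.cong sum_nonneg simp: axis_def)
    finally have "\<alpha> * (b \<bullet> f v)\<^sup>2 + \<beta> * (norm (f v - (b \<bullet> f v) *\<^sub>R b))\<^sup>2
        = \<alpha> * (v $ k)\<^sup>2 + \<beta> * (\<Sum>i\<in>UNIV. if i = k then 0 else (v $ i)\<^sup>2)"
      by (simp add: bv)
    also have "\<dots> = (\<Sum>i\<in>UNIV. d i * (v $ i)\<^sup>2)"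
      by (simp add: sum.remove[of UNIV k] d_def sum_distrib_left)
    finally have "(\<Sum>i\<in>UNIV. d i * (v $ i)\<^sup>2) \<le> f v \<bullet> (A *v f v)" using A[of "f v"] by simp
    also have "f v \<bullet> (A *v f v) = v \<bullet> ((transpose U ** A ** U) *v v)"
      unfolding fU by (metis dot_lmul_matrix matrix_vector_mul_assoc transpose_matrix_vector
          transpose_transpose)
    finally show "(\<Sum>i\<in>UNIV. d i * (v $ i)\<^sup>2) \<le> v \<bullet> ((transpose U ** A ** U) *v v)" .
  qed
  moreover have "det U * det U = 1"
    using U by (metis det_I det_mul det_transpose orthogonal_matrix)
  then have "det (transpose U ** A ** U) = det A"
    by (simp add: det_mul det_transpose)
  moreover have "(\<Prod>i\<in>UNIV. d i) = \<alpha> * \<beta> ^ (CARD('n) - 1)"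
    by (simp add: prod.remove[of UNIV k] d_def card_Diff_singleton)
  ultimately show ?thesis by simp
qed

section \<open>Positive definite matrices and the residual sum of squares\<close>

lemma inner_matrix_vector: "x \<bullet> (A *v y) = (transpose A *v x) \<bullet> (y :: real^'n)"
  by (simp add: dot_lmul_matrix)

lemma matrix_inv_vector_cancel:
  fixes A :: "real^'n^'n"
  assumes "invertible A"
  shows "A *v (matrix_inv A *v v) = v" "matrix_inv A *v (A *v v) = v"
proof -
  have "A ** matrix_inv A = mat 1 \<and> matrix_inv A ** A = mat 1"
    using assms unfolding matrix_inv_def invertible_def by (rule someI_ex)
  then show "A *v (matrix_inv A *v v) = v" "matrix_inv A *v (A *v v) = v"
    by (simp_all add: matrix_vector_mul_assoc)
qed

lemma pos_def_symmetric: "pos_def R \<Longrightarrow> x \<bullet> (R *v y) = y \<bullet> (R *v x)"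
  by (metis inner_commute inner_matrix_vector pos_def_def)

lemma pos_def_nonneg: "pos_def R \<Longrightarrow> 0 \<le> v \<bullet> (R *v v)"
  by (cases "v = 0") (auto simp: pos_def_def less_imp_le)

lemma pos_def_invertible:
  assumes "pos_def R" shows "invertible R"
  by (rule invertible_if_injective) (metis assms inner_zero_right less_irrefl pos_def_def)

lemma pos_def_det: "pos_def R \<Longrightarrow> 0 < det R"
  by (rule det_pos_if_quadratic_form_pos) (simp add: pos_def_def)

lemma pos_def_Cauchy_Schwarz:
  assumes R: "pos_def R"
  shows "(u \<bullet> (R *v w))\<^sup>2 \<le> (u \<bullet> (R *v u)) * (w \<bullet> (R *v w))"
proof (cases "w = 0")
  case False
  define p q r where "p = u \<bullet> (R *v u)" and "q = u \<bullet> (R *v w)" and "r = w \<bullet> (R *v w)"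
  have r: "0 < r" using False R by (simp add: r_def pos_def_def)
  have "0 \<le> (r *\<^sub>R u - q *\<^sub>R w) \<bullet> (R *v (r *\<^sub>R u - q *\<^sub>R w))" by (rule pos_def_nonneg[OF R])
  also have "\<dots> = r * (r * p - q\<^sup>2)"
    unfolding p_def q_def r_def
    by (simp add: matrix_vector_mult_diff_distrib matrix_vector_mult_scaleR inner_diff_left
        inner_diff_right pos_def_symmetric[OF R, of w u] power2_eq_square algebra_simps)
  finally show ?thesis using r by (simp add: zero_le_mult_iff mult.commute p_def q_def r_def)
qed simp

text \<open>Every test vector \<open>u\<close> gives a lower bound for the quadratic form of \<open>R\<^sup>-\<^sup>1\<close> in terms of an upper bound
  for that of \<open>R\<close>.\<close>

lemma pos_def_inverse_Cauchy_Schwarz: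
  assumes R: "pos_def R"
  shows "(w \<bullet> u)\<^sup>2 \<le> (u \<bullet> (R *v u)) * (w \<bullet> (matrix_inv R *v w))"
proof -
  have "R *v (matrix_inv R *v w) = w"
    by (rule matrix_inv_vector_cancel) (rule pos_def_invertible[OF R])
  then show ?thesis
    using pos_def_Cauchy_Schwarz[OF R, of u "matrix_inv R *v w"] by (simp add: inner_commute)
qed

lemma gram_quadratic_form:
  fixes H :: "real^'q^'n"
  shows "v \<bullet> ((transpose H ** matrix_inv R ** H) *v v) = (H *v v) \<bullet> (matrix_inv R *v (H *v v))"
  by (simp add: matrix_vector_mul_assoc[symmetric] inner_matrix_vector del: transpose_matrix_vector)

lemma inverse_quadratic_form_pos:
  assumes R: "pos_def R" and "w \<noteq> 0"
  shows "0 < w \<bullet> (matrix_inv R *v w)"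
proof -
  have eq: "R *v (matrix_inv R *v w) = w"
    by (rule matrix_inv_vector_cancel) (rule pos_def_invertible[OF R])
  then have "matrix_inv R *v w \<noteq> 0" using assms(2) by force
  then have "0 < (matrix_inv R *v w) \<bullet> (R *v (matrix_inv R *v w))"
    using R by (simp add: pos_def_def)
  then show ?thesis by (simp add: eq inner_commute)
qed

lemma gram_quadratic_form_pos:
  fixes H :: "real^'q^'n"
  assumes R: "pos_def R" and H: "inj ((*v) H)" and "v \<noteq> 0"
  shows "0 < v \<bullet> ((transpose H ** matrix_inv R ** H) *v v)"
  unfolding gram_quadratic_form using assms
  by (intro inverse_quadratic_form_pos) (auto simp: dest: injD[of _ v 0])

text \<open>Here \<open>u = Q y = R\<^sup>-\<^sup>1 (y - H \<beta>)\<close>, with \<open>\<beta>\<close> the generalised least squares estimate: the normal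
  equations say that \<open>u\<close> is orthogonal to the columns of \<open>H\<close>. All bounds for \<open>S\<^sup>2\<close> below use only these
  relations and never the explicit form of \<open>Q\<close>.\<close>

lemma generalised_least_squares_residual:
  fixes H :: "real^'q^'n"
  assumes R: "pos_def R" and H: "inj ((*v) H)"
  obtains u \<beta> where "R *v u = y - H *v \<beta>" "\<And>v. u \<bullet> (H *v v) = 0"
    "S2 R H y = u \<bullet> (R *v u)" "S2 R H y = y \<bullet> u"
proof -
  define X where "X = transpose H ** matrix_inv R ** H"
  have "invertible X"
    by (rule invertible_if_injective) 
      (metis X_def gram_quadratic_form_pos[OF R H] inner_zero_right less_irrefl)
  note X = matrix_inv_vector_cancel[OF this]
  note Ri = matrix_inv_vector_cancel[OF pos_def_invertible[OF R]]
  define \<beta> where "\<beta> = matrix_inv X *v (transpose H *v (matrix_inv R *v y))"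
  define u where "u = Q_mat R H *v y"
  have u: "u = matrix_inv R *v (y - H *v \<beta>)"
    by (simp add: u_def Q_mat_def \<beta>_def matrix_vector_mult_diff_rdistrib matrix_vector_mult_diff_distrib
        X_def[symmetric] matrix_vector_mul_assoc[symmetric] del: transpose_matrix_vector)
  have 1: "R *v u = y - H *v \<beta>" by (simp add: u Ri)
  have "transpose H *v u = transpose H *v (matrix_inv R *v y) - X *v \<beta>"
    by (simp add: u X_def matrix_vector_mult_diff_distrib matrix_vector_mul_assoc[symmetric]
       del: transpose_matrix_vector)
  then have "transpose H *v u = 0" by (simp add: \<beta>_def X del: transpose_matrix_vector)
  then have 2: "u \<bullet> (H *v v) = 0" for v by (simp add: inner_matrix_vector)
  have 3: "S2 R H y = y \<bullet> u" by (simp add: S2_def u_def)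
  have "u \<bullet> (R *v u) = y \<bullet> u" by (simp add: 1 inner_diff_right 2 inner_commute)
  then show ?thesis using that 1 2 3 by metis
qed

lemma S2_nonneg:
  fixes H :: "real^'q^'n"
  assumes "pos_def R" "inj ((*v) H)"
  shows "0 \<le> S2 R H y"
  using generalised_least_squares_residual[OF assms] pos_def_nonneg[OF assms(1)] by metis

lemma S2_pos:
  fixes H :: "real^'q^'n"
  assumes R: "pos_def R" and H: "inj ((*v) H)" and y: "y \<notin> range ((*v) H)"
  shows "0 < S2 R H y"
proof -
  obtain u \<beta> where u: "R *v u = y - H *v \<beta>" "S2 R H y = u \<bullet> (R *v u)"
    by (rule generalised_least_squares_residual[OF R H])
  have "u \<noteq> 0" using u(1) y by auto
  then show ?thesis using R u(2) by (simp add: pos_def_def)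
qed

text \<open>The two expressions for \<open>S\<^sup>2\<close> give \<open>k \<parallel>u\<parallel>\<^sup>2 \<le> u\<^sup>T R u = y\<^sup>T u \<le> \<parallel>y\<parallel> \<parallel>u\<parallel>\<close>, which bounds \<open>\<parallel>u\<parallel>\<close> and then \<open>S\<^sup>2\<close>.\<close>

lemma S2_upper:
  fixes H :: "real^'q^'n"
  assumes R: "pos_def R" and H: "inj ((*v) H)"
    and "0 < k" and k: "\<And>v. k * (norm v)\<^sup>2 \<le> v \<bullet> (R *v v)"
  shows "S2 R H y \<le> (norm y)\<^sup>2 / k"
proof -
  obtain u where u: "S2 R H y = u \<bullet> (R *v u)" "S2 R H y = y \<bullet> u"
    using generalised_least_squares_residual[OF R H] by metis
  have yu: "k * (norm u)\<^sup>2 \<le> norm y * norm u"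
    using k[of u] u norm_cauchy_schwarz[of y u] by linarith
  have nu: "norm u \<le> norm y / k"
  proof (cases "u = 0")
    case False
    then show ?thesis using yu \<open>0 < k\<close> by (simp add: power2_eq_square field_simps)
  qed (use \<open>0 < k\<close> in auto)
  have "S2 R H y \<le> norm y * norm u" using u(2) norm_cauchy_schwarz[of y u] by simp
  also have "\<dots> \<le> norm y * (norm y / k)" by (intro mult_left_mono nu) auto
  finally show ?thesis by (simp add: power2_eq_square)
qed

text \<open>A vector \<open>w\<close> orthogonal to the columns of \<open>H\<close> does not see the fitted part of \<open>y\<close>, so that
  \<open>w\<^sup>T y = w\<^sup>T R u\<close>; the Cauchy-Schwarz inequality for the form \<open>R\<close> then applies.\<close>

lemma S2_lower:
  fixes H :: "real^'q^'n"
  assumes R: "pos_def R" and H: "inj ((*v) H)" and w: "\<And>v. w \<bullet> (H *v v) = 0"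
  shows "(w \<bullet> y)\<^sup>2 \<le> (w \<bullet> (R *v w)) * S2 R H y"
proof -
  obtain u \<beta> where u: "R *v u = y - H *v \<beta>" "S2 R H y = u \<bullet> (R *v u)"
    by (rule generalised_least_squares_residual[OF R H])
  then have "w \<bullet> (R *v u) = w \<bullet> y" by (simp add: inner_diff_right w)
  then show ?thesis using pos_def_Cauchy_Schwarz[OF R, of w u] u(2) by metis
qed

section \<open>Continuity of the likelihood kernels\<close>

lemma tendsto_matrix_matrix_mult:
  fixes A :: "'a \<Rightarrow> real^'m^'n" and B :: "'a \<Rightarrow> real^'k^'m"
  assumes "(A \<longlongrightarrow> A0) F" "(B \<longlongrightarrow> B0) F"
  shows "((\<lambda>t. A t ** B t) \<longlongrightarrow> A0 ** B0) F"
  unfolding matrix_matrix_mult_def by (intro tendsto_intros assms)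

lemma tendsto_matrix_vector_mult:
  fixes A :: "'a \<Rightarrow> real^'m^'n"
  assumes "(A \<longlongrightarrow> A0) F"
  shows "((\<lambda>t. A t *v v) \<longlongrightarrow> A0 *v v) F"
  unfolding matrix_vector_mult_def by (intro tendsto_intros assms)

text \<open>By Cramer's rule the entries of the inverse are quotients of determinants, which are polynomials
  in the entries of the matrix.\<close>

lemma tendsto_matrix_inv:
  fixes A :: "'a \<Rightarrow> real^'n^'n"
  assumes A: "(A \<longlongrightarrow> A0) F" and A0: "det A0 \<noteq> 0"
  shows "((\<lambda>t. matrix_inv (A t)) \<longlongrightarrow> matrix_inv A0) F"
proof -
  \<comment> \<open>the numerator in Cramer's rule for entry \<open>(i, k)\<close> of the inverse\<close>
  define N where "N M i k = det (\<chi> r s. if s = i then axis k 1 $ r else M $ r $ s)"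
    for M :: "real^'n^'n" and i k
  have inv: "matrix_inv M = (\<chi> i k. N M i k / det M)" if "det M \<noteq> 0" for M :: "real^'n^'n"
  proof -
    have "matrix_inv M $ i $ k = N M i k / det M" for i k
    proof -
      have "M *v (matrix_inv M *v axis k 1) = axis k 1"
        using that by (intro matrix_inv_vector_cancel) (simp add: invertible_det_nz)
      then have "(matrix_inv M *v axis k 1) $ i = N M i k / det M"
        using cramer[OF that, of "matrix_inv M *v axis k 1" "axis k 1"] by (simp add: N_def)
      then show ?thesis by (simp add: matrix_vector_mult_basis column_def)
    qed
    then show ?thesis by (simp add: vec_eq_iff)
  qed
  have "((\<lambda>t. N (A t) i k) \<longlongrightarrow> N A0 i k) F" for i k
    unfolding N_def
  proof (intro tendsto_det tendsto_vec_lambda)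
    show "((\<lambda>t. if s = i then axis k 1 $ r else A t $ r $ s) \<longlongrightarrow>
      (if s = i then axis k 1 $ r else A0 $ r $ s)) F" for r s
      by (auto intro!: tendsto_intros A)
  qed
  then have "((\<lambda>t. \<chi> i k. N (A t) i k / det (A t)) \<longlongrightarrow> (\<chi> i k. N A0 i k / det A0)) F"
    by (intro tendsto_vec_lambda tendsto_divide tendsto_det A A0)
  then have "((\<lambda>t. \<chi> i k. N (A t) i k / det (A t)) \<longlongrightarrow> matrix_inv A0) F" by (simp add: inv A0)
  moreover have "\<forall>\<^sub>F t in F. (\<chi> i k. N (A t) i k / det (A t)) = matrix_inv (A t)"
    using tendsto_imp_eventually_ne[OF tendsto_det[OF A] A0] by eventually_elim (simp add: inv)
  ultimately show ?thesis by (rule Lim_transform_eventually)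
qed

lemma tendsto_S2:
  fixes H :: "real^'q^'n"
  assumes A: "(A \<longlongrightarrow> R) F" and R: "pos_def R" and H: "inj ((*v) H)"
  shows "((\<lambda>t. det (transpose H ** matrix_inv (A t) ** H)) \<longlongrightarrow>
           det (transpose H ** matrix_inv R ** H)) F"
    and "((\<lambda>t. S2 (A t) H y) \<longlongrightarrow> S2 R H y) F"
proof -
  have "det R \<noteq> 0" using pos_def_det[OF R] by simp
  note Ai = tendsto_matrix_inv[OF A this]
  have X: "((\<lambda>t. transpose H ** matrix_inv (A t) ** H) \<longlongrightarrow> transpose H ** matrix_inv R ** H) F"
    by (intro tendsto_matrix_matrix_mult Ai tendsto_const)
  then show "((\<lambda>t. det (transpose H ** matrix_inv (A t) ** H)) \<longlongrightarrow>
           det (transpose H ** matrix_inv R ** H)) F" by (rule tendsto_det)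
  have dX: "det (transpose H ** matrix_inv R ** H) \<noteq> 0"
    using det_pos_if_quadratic_form_pos[OF gram_quadratic_form_pos[OF R H]] by simp
  show "((\<lambda>t. S2 (A t) H y) \<longlongrightarrow> S2 R H y) F"
    unfolding S2_def Q_mat_def
    by (intro tendsto_inner tendsto_const tendsto_matrix_vector_mult tendsto_diff
        tendsto_matrix_matrix_mult Ai tendsto_matrix_inv[OF X dX])
qed

lemma likelihood_kernels_tendsto_pos:
  fixes H :: "real^'q^'n"
  assumes A: "(A \<longlongrightarrow> R) F" and R: "pos_def R" and H: "inj ((*v) H)"
    and y: "y \<notin> range ((*v) H)"
  shows "\<exists>r>0. ((\<lambda>t. marginal_kernel a (A t) H y) \<longlongrightarrow> r) F"
    and "\<exists>r>0. ((\<lambda>t. profile_kernel (A t) H y) \<longlongrightarrow> r) F"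
proof -
  have pos: "0 < det R" "0 < det (transpose H ** matrix_inv R ** H)" "0 < S2 R H y"
    using pos_def_det[OF R] det_pos_if_quadratic_form_pos[OF gram_quadratic_form_pos[OF R H]]
      S2_pos[OF R H y] by auto
  have "((\<lambda>t. marginal_kernel a (A t) H y) \<longlongrightarrow> marginal_kernel a R H y) F"
    unfolding marginal_kernel_def
    by (intro tendsto_mult tendsto_powr tendsto_const tendsto_det A tendsto_S2[OF A R H])
      (use pos in auto)
  then show "\<exists>r>0. ((\<lambda>t. marginal_kernel a (A t) H y) \<longlongrightarrow> r) F"
    using pos by (intro exI[of _ "marginal_kernel a R H y"]) (auto simp: marginal_kernel_def)
  have "((\<lambda>t. profile_kernel (A t) H y) \<longlongrightarrow> profile_kernel R H y) F"
    unfolding profile_kernel_def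
    by (intro tendsto_mult tendsto_powr tendsto_const tendsto_det A tendsto_S2[OF A R H])
      (use pos in auto)
  then show "\<exists>r>0. ((\<lambda>t. profile_kernel (A t) H y) \<longlongrightarrow> r) F"
    using pos by (intro exI[of _ "profile_kernel R H y"]) (auto simp: profile_kernel_def)
qed

section \<open>Likelihood kernels of a spiked matrix\<close>

text \<open>For a unit vector \<open>b\<close>, the component of \<open>v\<close> orthogonal to \<open>b\<close>.\<close>

definition reject :: "'a::real_inner \<Rightarrow> 'a \<Rightarrow> 'a" where
  "reject b v = v - (b \<bullet> v) *\<^sub>R b"

lemma linear_reject: "linear (reject b)"
  by (rule linearI) (simp_all add: reject_def inner_add_right algebra_simps)

lemma
  assumes "norm b = 1"
  shows reject_orthogonal: "b \<bullet> reject b v = 0"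
    and reject_self: "reject b b = 0"
    and inner_reject: "v \<bullet> reject b v = (norm (reject b v))\<^sup>2"
    and norm_reject: "(norm v)\<^sup>2 = (b \<bullet> v)\<^sup>2 + (norm (reject b v))\<^sup>2"
proof -
  have bb: "b \<bullet> b = 1" using assms by (simp add: dot_square_norm)
  then show "b \<bullet> reject b v = 0" "reject b b = 0" by (simp_all add: reject_def inner_diff_right)
  show "v \<bullet> reject b v = (norm (reject b v))\<^sup>2"
    unfolding power2_norm_eq_inner using bb
    by (simp add: reject_def inner_diff_right inner_diff_left inner_commute)
  show "(norm v)\<^sup>2 = (b \<bullet> v)\<^sup>2 + (norm (reject b v))\<^sup>2"
    unfolding power2_norm_eq_inner using bb
    by (simp add: reject_def inner_diff_right inner_diff_left inner_commute power2_eq_square)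
qed

text \<open>The matrix is comparable, as a quadratic form, with \<open>b b\<^sup>T + s I\<close>: one direction \<open>b\<close> of order \<open>1\<close>
  and all orthogonal ones of order \<open>s\<close>. The constants \<open>c\<close> and \<open>C\<close> are parameters because every bound
  below has to be uniform over all such \<open>R\<close> and \<open>s\<close>.\<close>

definition spiked :: "real \<Rightarrow> real \<Rightarrow> real^'n \<Rightarrow> real \<Rightarrow> real^'n^'n \<Rightarrow> bool" where
  "spiked c C b s R \<longleftrightarrow> pos_def R \<and> 0 < s \<and> s \<le> 1 \<and>
     (\<forall>v. c * ((b \<bullet> v)\<^sup>2 + s * (norm (reject b v))\<^sup>2) \<le> v \<bullet> (R *v v)) \<and>
     (\<forall>v. v \<bullet> (R *v v) \<le> C * (norm v)\<^sup>2) \<and>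
     (\<forall>v. b \<bullet> v = 0 \<longrightarrow> v \<bullet> (R *v v) \<le> C * s * (norm v)\<^sup>2)"

lemma spikedD:
  assumes "spiked c C b s R"
  shows "pos_def R" "0 < s" "s \<le> 1"
    and "c * ((b \<bullet> v)\<^sup>2 + s * (norm (reject b v))\<^sup>2) \<le> v \<bullet> (R *v v)"
    and "v \<bullet> (R *v v) \<le> C * (norm v)\<^sup>2"
    and "b \<bullet> v = 0 \<Longrightarrow> v \<bullet> (R *v v) \<le> C * s * (norm v)\<^sup>2"
  using assms unfolding spiked_def by blast+

lemma spiked_det_lower:
  fixes b :: "real^'n"
  assumes b: "norm b = 1" and c: "0 < c" and R: "spiked c C b s R"
  shows "c ^ CARD('n) * s powr (real CARD('n) - 1) \<le> det R"
proof -
  have s: "0 < s" by (rule spikedD[OF R])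
  have n: "real CARD('n) - 1 = real (CARD('n) - 1)" by (simp add: of_nat_diff Suc_leI)
  have "c * (c * s) ^ (CARD('n) - 1) \<le> det R"
  proof (rule det_ge_if_quadratic_form_ge_along_direction[OF b c])
    show "c * (b \<bullet> v)\<^sup>2 + c * s * (norm (v - (b \<bullet> v) *\<^sub>R b))\<^sup>2 \<le> v \<bullet> (R *v v)" for v
      using spikedD(4)[OF R, of v] by (simp add: reject_def distrib_left mult.assoc)
  qed (use c s in simp)
  moreover have "c * (c * s) ^ (CARD('n) - 1) = c ^ CARD('n) * s powr (real CARD('n) - 1)"
  proof -
    have "c * c ^ (CARD('n) - 1) = c ^ CARD('n)"
      by (metis power_minus_mult mult.commute zero_less_card_finite)
    moreover have "c * (c * s) ^ (CARD('n) - 1) = c * c ^ (CARD('n) - 1) * s ^ (CARD('n) - 1)"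
      by (simp add: power_mult_distrib)
    ultimately show ?thesis unfolding n powr_realpow[OF s] by metis
  qed
  ultimately show ?thesis by simp
qed

text \<open>These are the Cauchy-Schwarz bounds with the test vectors \<open>w\<close> and \<open>reject b w\<close>. The second one
  profits from the small size of \<open>R\<close> orthogonally to \<open>b\<close>.\<close>

lemma spiked_inverse_lower:
  assumes b: "norm b = 1" and C: "0 < C" and R: "spiked c C b s R"
  shows "(norm w)\<^sup>2 / C \<le> w \<bullet> (matrix_inv R *v w)"
    and "(norm (reject b w))\<^sup>2 / (C * s) \<le> w \<bullet> (matrix_inv R *v w)"
proof -
  have *: "(norm u)\<^sup>2 / k \<le> w \<bullet> (matrix_inv R *v w)"
    if k: "0 < k" and u: "w \<bullet> u = (norm u)\<^sup>2" "u \<bullet> (R *v u) \<le> k * (norm u)\<^sup>2" for u k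
  proof (cases "u = 0")
    case True
    have pd: "pos_def R" by (rule spikedD[OF R])
    show ?thesis using True inverse_quadratic_form_pos[OF pd, of w] by (cases "w = 0") auto
  next
    case False
    let ?Z = "w \<bullet> (matrix_inv R *v w)"
    have pd: "pos_def R" by (rule spikedD[OF R])
    have Z: "0 \<le> ?Z" using inverse_quadratic_form_pos[OF pd, of w] by (cases "w = 0") auto
    have "((norm u)\<^sup>2)\<^sup>2 \<le> (u \<bullet> (R *v u)) * ?Z"
      using pos_def_inverse_Cauchy_Schwarz[OF pd, of w u] u by simp
    also have "\<dots> \<le> k * (norm u)\<^sup>2 * ?Z" by (intro mult_right_mono u Z)
    finally have "(norm u)\<^sup>2 * (norm u)\<^sup>2 \<le> (norm u)\<^sup>2 * (k * ?Z)"
      by (simp add: power2_eq_square algebra_simps)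
    then have "(norm u)\<^sup>2 \<le> k * ?Z" using False by (subst (asm) mult_le_cancel_left_pos) auto
    then show ?thesis using k by (simp add: field_simps)
  qed
  show "(norm w)\<^sup>2 / C \<le> w \<bullet> (matrix_inv R *v w)"
    by (rule *[OF C _ spikedD(5)[OF R]]) (simp add: dot_square_norm)
  show "(norm (reject b w))\<^sup>2 / (C * s) \<le> w \<bullet> (matrix_inv R *v w)"
    by (rule *[OF _ inner_reject[OF b] spikedD(6)[OF R reject_orthogonal[OF b]]])
      (use C spikedD(2)[OF R] in simp)
qed

text \<open>If \<open>b\<close> is not in the column space, no nonzero vector \<open>H v\<close> is a multiple of \<open>b\<close>, so its component
  orthogonal to \<open>b\<close> has a norm comparable with that of \<open>v\<close>. The inverse is of order \<open>1 / s\<close> on this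
  component, and the Gram matrix is of this order in all \<open>q\<close> directions.\<close>

lemma spiked_gram_det_lower:
  fixes H :: "real^'q^'n" and b :: "real^'n"
  assumes b: "norm b = 1" and C: "0 < C" and H: "inj ((*v) H)" and nin: "b \<notin> range ((*v) H)"
  shows "\<exists>k>0. \<forall>s R. spiked c C b s R \<longrightarrow>
    k * s powr (- real CARD('q)) \<le> det (transpose H ** matrix_inv R ** H)"
proof -
  have lin: "linear (\<lambda>v. reject b (H *v v))"
    using linear_compose[OF matrix_vector_mul_linear linear_reject] by (simp add: o_def)
  have "v = 0" if "reject b (H *v v) = 0" for v
  proof -
    have 1: "H *v v = (b \<bullet> (H *v v)) *\<^sub>R b" using that by (simp add: reject_def)
    have "b \<bullet> (H *v v) = 0"
    proof (rule ccontr)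
      assume "b \<bullet> (H *v v) \<noteq> 0"
      then have "b = H *v ((1 / (b \<bullet> (H *v v))) *\<^sub>R v)"
        using 1 by (metis divideR_right matrix_vector_mult_scaleR scaleR_one inverse_eq_divide)
      then show False using nin by blast
    qed
    then have "H *v v = H *v 0" using 1 by simp
    then show "v = 0" using H by (meson injD)
  qed
  then obtain e where e: "0 < e" "\<And>v. e * norm v \<le> norm (reject b (H *v v))"
    using injective_imp_isometric[of UNIV "\<lambda>v. reject b (H *v v)"] lin
    by (auto simp: linear_conv_bounded_linear mult.commute)
  show ?thesis
  proof (intro exI[of _ "(e\<^sup>2 / C) ^ CARD('q)"] conjI allI impI)
    show "0 < (e\<^sup>2 / C) ^ CARD('q)" using e C by simp
    fix s and R assume R: "spiked c C b s R"
    then have s: "0 < s" by (rule spikedD(2))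
    have "(\<Prod>i::'q\<in>UNIV. e\<^sup>2 / (C * s)) \<le> det (transpose H ** matrix_inv R ** H)"
    proof (rule det_ge_prod_if_quadratic_form_ge)
      show "0 < e\<^sup>2 / (C * s)" using e C s by simp
      fix v :: "real^'q"
      have "(\<Sum>i\<in>UNIV. e\<^sup>2 / (C * s) * (v $ i)\<^sup>2) = e\<^sup>2 / (C * s) * (v \<bullet> v)"
        by (simp add: inner_vec_def sum_distrib_left power2_eq_square)
      also have "\<dots> = (e * norm v)\<^sup>2 / (C * s)" by (simp add: dot_square_norm power_mult_distrib)
      also have "\<dots> \<le> (norm (reject b (H *v v)))\<^sup>2 / (C * s)"
        using e C s by (intro divide_right_mono power_mono) auto
      also have "\<dots> \<le> v \<bullet> ((transpose H ** matrix_inv R ** H) *v v)"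
        unfolding gram_quadratic_form by (rule spiked_inverse_lower(2)[OF b C R])
      finally show "(\<Sum>i\<in>UNIV. e\<^sup>2 / (C * s) * (v $ i)\<^sup>2)
        \<le> v \<bullet> ((transpose H ** matrix_inv R ** H) *v v)" .
    qed
    also have "(\<Prod>i::'q\<in>UNIV. e\<^sup>2 / (C * s)) = (e\<^sup>2 / C) ^ CARD('q) * s powr (- real CARD('q))"
      using s by (simp add: powr_minus powr_realpow power_divide power_mult_distrib field_simps)
    finally show "(e\<^sup>2 / C) ^ CARD('q) * s powr (- real CARD('q))
      \<le> det (transpose H ** matrix_inv R ** H)" .
  qed
qed

text \<open>One direction of the coefficient space is now lost: for the unit vector \<open>\<beta>\<close> with \<open>H \<beta>\<close>
  proportional to \<open>b\<close>, only the bound of order \<open>1\<close> for the inverse is left. The \<open>q - 1\<close> directions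
  orthogonal to \<open>\<beta>\<close> behave as before.\<close>

lemma spiked_gram_det_lower_spike_in_range:
  fixes H :: "real^'q^'n" and b :: "real^'n"
  assumes b: "norm b = 1" and C: "0 < C" and H: "inj ((*v) H)" and bin: "b \<in> range ((*v) H)"
  shows "\<exists>k>0. \<forall>s R. spiked c C b s R \<longrightarrow>
    k * s powr (- (real CARD('q) - 1)) \<le> det (transpose H ** matrix_inv R ** H)"
proof -
  obtain \<beta>0 where \<beta>0: "b = H *v \<beta>0" using bin by blast
  have \<beta>00: "\<beta>0 \<noteq> 0" using \<beta>0 b by auto
  define \<beta> where "\<beta> = (1 / norm \<beta>0) *\<^sub>R \<beta>0"
  have \<beta>: "norm \<beta> = 1" using \<beta>00 by (simp add: \<beta>_def)
  have H\<beta>: "H *v \<beta> = (1 / norm \<beta>0) *\<^sub>R b" by (simp add: \<beta>_def \<beta>0 matrix_vector_mult_scaleR)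
  have lin: "linear (\<lambda>v. reject b (H *v v))"
    using linear_compose[OF matrix_vector_mul_linear linear_reject] by (simp add: o_def)
  have "v = 0" if "reject b (H *v v) = 0" "\<beta> \<bullet> v = 0" for v
  proof -
    have "H *v v = H *v ((b \<bullet> (H *v v)) *\<^sub>R \<beta>0)"
      using that by (simp add: reject_def matrix_vector_mult_scaleR flip: \<beta>0)
    then have v: "v = (b \<bullet> (H *v v)) *\<^sub>R \<beta>0" using H by (meson injD)
    then have "(b \<bullet> (H *v v)) * (\<beta> \<bullet> \<beta>0) = 0" using that(2) by (metis inner_scaleR_right)
    moreover have "\<beta> \<bullet> \<beta>0 \<noteq> 0" using \<beta>00 by (simp add: \<beta>_def)
    ultimately show "v = 0" using v by simp
  qed
  then obtain e where e: "0 < e" "\<And>v. \<beta> \<bullet> v = 0 \<Longrightarrow> e * norm v \<le> norm (reject b (H *v v))"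
    using injective_imp_isometric[of "{v. \<beta> \<bullet> v = 0}" "\<lambda>v. reject b (H *v v)"] lin
    by (auto simp: linear_conv_bounded_linear mult.commute closed_hyperplane subspace_hyperplane)
  have rej: "reject b (H *v v) = reject b (H *v reject \<beta> v)" for v
    by (simp add: reject_def[of \<beta>] linear_diff[OF lin] matrix_vector_mult_scaleR H\<beta>
        linear_cmul[OF linear_reject] reject_self[OF b] linear_diff[OF linear_reject] 
        matrix_vector_mult_diff_distrib)
  have "v = 0" if "H *v v = 0" for v
    using injD[OF H, of v 0] that by simp
  then obtain f where f: "0 < f" "\<And>v. f * norm v \<le> norm (H *v v)"
    using injective_imp_isometric[of UNIV "\<lambda>v. H *v v"]
    by (auto simp: mult.commute)
  show ?thesis
  proof (intro exI[of _ "(f\<^sup>2 / (2 * C)) * (e\<^sup>2 / (2 * C)) ^ (CARD('q) - 1)"] conjI allI impI)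
    show "0 < (f\<^sup>2 / (2 * C)) * (e\<^sup>2 / (2 * C)) ^ (CARD('q) - 1)" using e f C by simp
    fix s and R assume R: "spiked c C b s R"
    then have s: "0 < s" by (rule spikedD(2))
    have "(f\<^sup>2 / (2 * C)) * (e\<^sup>2 / (2 * C * s)) ^ (CARD('q) - 1)
        \<le> det (transpose H ** matrix_inv R ** H)"
    proof (rule det_ge_if_quadratic_form_ge_along_direction[OF \<beta>], unfold reject_def[symmetric])
      show "0 < f\<^sup>2 / (2 * C)" "0 < e\<^sup>2 / (2 * C * s)" using e f C s by auto
      fix v
      have "(f * norm v)\<^sup>2 / C \<le> (norm (H *v v))\<^sup>2 / C"
        using f C by (intro divide_right_mono power_mono) auto
      also have "\<dots> \<le> v \<bullet> ((transpose H ** matrix_inv R ** H) *v v)"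
        unfolding gram_quadratic_form by (rule spiked_inverse_lower(1)[OF b C R])
      finally have 1: "f\<^sup>2 / C * (norm v)\<^sup>2 \<le> v \<bullet> ((transpose H ** matrix_inv R ** H) *v v)"
        by (simp add: power_mult_distrib)
      have "f\<^sup>2 / C * (\<beta> \<bullet> v)\<^sup>2 \<le> f\<^sup>2 / C * (norm v)\<^sup>2"
        unfolding norm_reject[OF \<beta>, of v] using f C by (intro mult_left_mono) auto
      note 1 = order_trans[OF this 1]
      have "(e * norm (reject \<beta> v))\<^sup>2 / (C * s) \<le> (norm (reject b (H *v v)))\<^sup>2 / (C * s)"
        unfolding rej[of v] using e C s reject_orthogonal[OF \<beta>]
        by (intro divide_right_mono power_mono) auto
      also have "\<dots> \<le> v \<bullet> ((transpose H ** matrix_inv R ** H) *v v)"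
        unfolding gram_quadratic_form by (rule spiked_inverse_lower(2)[OF b C R])
      finally have 2: "e\<^sup>2 / (C * s) * (norm (reject \<beta> v))\<^sup>2
          \<le> v \<bullet> ((transpose H ** matrix_inv R ** H) *v v)"
        by (simp add: power_mult_distrib)
      have average_le: "x / 2 + y / 2 \<le> z" if "x \<le> z" "y \<le> z" for x y z :: real
        using that by simp
      have half: "f\<^sup>2 / (2 * C) * x = (f\<^sup>2 / C * x) / 2"
        "e\<^sup>2 / (2 * C * s) * x = (e\<^sup>2 / (C * s) * x) / 2" for x by simp_all
      show "f\<^sup>2 / (2 * C) * (\<beta> \<bullet> v)\<^sup>2 + e\<^sup>2 / (2 * C * s) * (norm (reject \<beta> v))\<^sup>2
        \<le> v \<bullet> ((transpose H ** matrix_inv R ** H) *v v)"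
        unfolding half by (rule average_le[OF 1 2])
    qed
    moreover have "(e\<^sup>2 / (2 * C * s)) ^ (CARD('q) - 1)
        = (e\<^sup>2 / (2 * C)) ^ (CARD('q) - 1) * s powr (- (real CARD('q) - 1))"
    proof -
      have "real CARD('q) - 1 = real (CARD('q) - 1)" by (simp add: of_nat_diff Suc_leI)
      then show ?thesis
        using s by (simp only: powr_minus powr_realpow)
          (simp add: power_divide power_mult_distrib field_simps)
    qed
    ultimately show "(f\<^sup>2 / (2 * C)) * (e\<^sup>2 / (2 * C)) ^ (CARD('q) - 1) *
      s powr (- (real CARD('q) - 1)) \<le> det (transpose H ** matrix_inv R ** H)"
      by (simp add: mult.assoc)
  qed
qed

lemma spiked_S2_upper:
  fixes H :: "real^'q^'n"
  assumes b: "norm b = 1" and c: "0 < c" and H: "inj ((*v) H)" and R: "spiked c C b s R"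
  shows "S2 R H y \<le> (norm y)\<^sup>2 / c / s"
proof -
  have s: "0 < s" "s \<le> 1" by (rule spikedD[OF R])+
  have "S2 R H y \<le> (norm y)\<^sup>2 / (c * s)"
  proof (rule S2_upper)
    show "pos_def R" by (rule spikedD[OF R])
    show "0 < c * s" using c s by simp
    fix v
    have "s * (b \<bullet> v)\<^sup>2 \<le> 1 * (b \<bullet> v)\<^sup>2" by (intro mult_right_mono s) auto
    then have "c * (s * (norm v)\<^sup>2) \<le> c * ((b \<bullet> v)\<^sup>2 + s * (norm (reject b v))\<^sup>2)"
      unfolding norm_reject[OF b, of v] using c by (intro mult_left_mono) (auto simp: distrib_left)
    then show "c * s * (norm v)\<^sup>2 \<le> v \<bullet> (R *v v)"
      using spikedD(4)[OF R, of v] by (simp add: mult.assoc)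
  qed (rule H)
  then show ?thesis by simp
qed

text \<open>The component of \<open>y\<close> orthogonal to \<open>b\<close> and to the columns of \<open>H\<close> serves as the test vector. Its
  quadratic form is of order \<open>s\<close>.\<close>

lemma spiked_S2_lower:
  fixes H :: "real^'q^'n"
  assumes C: "0 < C" and H: "inj ((*v) H)"
    and y: "y \<notin> span (insert b (range ((*v) H)))"
  shows "\<exists>k>0. \<forall>s R. spiked c C b s R \<longrightarrow> k / s \<le> S2 R H y"
proof -
  obtain p w where p: "p \<in> span (insert b (range ((*v) H)))"
    and w: "\<And>u. u \<in> span (insert b (range ((*v) H))) \<Longrightarrow> orthogonal w u" and y_eq: "y = p + w"
    using orthogonal_subspace_decomp_exists[of "insert b (range ((*v) H))" y] by metis
  have w0: "w \<noteq> 0" using y p y_eq by auto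
  have wb: "b \<bullet> w = 0" using w[of b] by (simp add: span_base orthogonal_def inner_commute)
  have wH: "w \<bullet> (H *v v) = 0" for v using w[of "H *v v"] by (simp add: span_base orthogonal_def)
  have wy: "w \<bullet> y = (norm w)\<^sup>2"
    using w[OF p] by (simp add: y_eq inner_add_right orthogonal_def dot_square_norm)
  show ?thesis
  proof (intro exI[of _ "(norm w)\<^sup>2 / C"] conjI allI impI)
    show "0 < (norm w)\<^sup>2 / C" using w0 C by simp
    fix s R assume R: "spiked c C b s R"
    then have s: "0 < s" and pd: "pos_def R" by (rule spikedD)+
    have "(w \<bullet> y)\<^sup>2 \<le> (w \<bullet> (R *v w)) * S2 R H y" by (rule S2_lower[OF pd H wH])
    also have "\<dots> \<le> C * s * (norm w)\<^sup>2 * S2 R H y"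
      by (intro mult_right_mono S2_nonneg[OF pd H] spikedD(6)[OF R wb])
    finally have "(norm w)\<^sup>2 * (norm w)\<^sup>2 \<le> (norm w)\<^sup>2 * (C * s * S2 R H y)"
      by (simp add: wy power2_eq_square algebra_simps)
    then have "(norm w)\<^sup>2 \<le> C * s * S2 R H y"
      using w0 by (subst (asm) mult_le_cancel_left_pos) auto
    then show "(norm w)\<^sup>2 / C / s \<le> S2 R H y" using C s by (simp add: field_simps)
  qed
qed

lemma powr_neg_half_upper:
  fixes s :: real
  assumes "0 < k" "0 < s" "k * s powr p \<le> x"
  shows "x powr (- 1 / 2) \<le> k powr (- 1 / 2) * s powr (- p / 2)"
proof -
  have "x powr (- 1 / 2) \<le> (k * s powr p) powr (- 1 / 2)"
    using assms by (intro powr_mono2') auto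
  also have "\<dots> = k powr (- 1 / 2) * s powr (- p / 2)"
    using assms by (simp add: powr_mult powr_powr)
  finally show ?thesis .
qed

text \<open>For \<open>e \<le> 0\<close> the power is increasing in \<open>S\<^sup>2\<close> and the upper bound for \<open>S\<^sup>2\<close>, valid for every \<open>y\<close>,
  suffices. For \<open>e > 0\<close> it is decreasing, and the lower bound enters together with its condition
  on \<open>y\<close>.\<close>

lemma spiked_S2_powr_upper:
  fixes H :: "real^'q^'n"
  assumes b: "norm b = 1" and c: "0 < c" and C: "0 < C" and H: "inj ((*v) H)"
    and y: "y \<notin> span (insert b (range ((*v) H))) \<or> e \<le> 0"
  shows "\<exists>K\<ge>0. \<forall>s R. spiked c C b s R \<longrightarrow> S2 R H y powr (- e) \<le> K * s powr e"
proof (cases "e \<le> 0")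
  case True
  show ?thesis
  proof (intro exI[of _ "((norm y)\<^sup>2 / c) powr (- e)"] conjI allI impI)
    fix s R assume R: "spiked c C b s R"
    then have s: "0 < s" and pd: "pos_def R" by (rule spikedD)+
    have "S2 R H y powr (- e) \<le> ((norm y)\<^sup>2 / c / s) powr (- e)"
      using True spiked_S2_upper[OF b c H R] S2_nonneg[OF pd H] by (intro powr_mono2) auto
    also have "\<dots> = ((norm y)\<^sup>2 / c) powr (- e) / s powr (- e)"
      by (rule powr_divide)
    finally show "S2 R H y powr (- e) \<le> ((norm y)\<^sup>2 / c) powr (- e) * s powr e"
      by (simp add: powr_minus_divide[of s e])
  qed simp
next
  case False
  then obtain k where k: "0 < k" "\<And>s R. spiked c C b s R \<Longrightarrow> k / s \<le> S2 R H y"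
    using spiked_S2_lower[OF C H] y by metis
  show ?thesis
  proof (intro exI[of _ "k powr (- e)"] conjI allI impI)
    fix s R assume R: "spiked c C b s R"
    then have s: "0 < s" by (rule spikedD(2))
    have "S2 R H y powr (- e) \<le> (k / s) powr (- e)"
      using False k s R by (intro powr_mono2') auto
    also have "\<dots> = k powr (- e) / s powr (- e)"
      by (rule powr_divide)
    finally show "S2 R H y powr (- e) \<le> k powr (- e) * s powr e"
      by (simp add: powr_minus_divide[of s e])
  qed simp
qed

lemma spiked_profile_kernel_upper:
  fixes H :: "real^'q^'n"
  assumes b: "norm b = 1" and c: "0 < c" and C: "0 < C" and H: "inj ((*v) H)"
    and y: "y \<notin> span (insert b (range ((*v) H)))"
  shows "\<exists>K. \<forall>s R. spiked c C b s R \<longrightarrow> profile_kernel R H y \<le> K * s powr (1 / 2)"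
proof -
  define n where "n = real CARD('n)"
  obtain K where K: "0 \<le> K"
    "\<And>s R. spiked c C b s R \<Longrightarrow> S2 R H y powr (- (n / 2)) \<le> K * s powr (n / 2)"
    using spiked_S2_powr_upper[OF b c C H, of y "n / 2"] y by blast
  show ?thesis
  proof (intro exI[of _ "(c ^ CARD('n)) powr (- 1 / 2) * K"] allI impI)
    fix s R assume R: "spiked c C b s R"
    then have s: "0 < s" by (rule spikedD(2))
    have "det R powr (- 1 / 2) \<le> (c ^ CARD('n)) powr (- 1 / 2) * s powr (- (n - 1) / 2)"
      using spiked_det_lower[OF b c R] c s by (intro powr_neg_half_upper) (auto simp: n_def)
    then have "profile_kernel R H y \<le>
        ((c ^ CARD('n)) powr (- 1 / 2) * s powr (- (n - 1) / 2)) * (K * s powr (n / 2))"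
      unfolding profile_kernel_def using K(2)[OF R] by (intro mult_mono) (auto simp: n_def)
    also have "\<dots> = (c ^ CARD('n)) powr (- 1 / 2) * K * s powr (- (n - 1) / 2 + n / 2)"
      by (simp add: powr_add)
    also have "- (n - 1) / 2 + n / 2 = 1 / 2" by (simp add: field_simps)
    finally show "profile_kernel R H y \<le> (c ^ CARD('n)) powr (- 1 / 2) * K * s powr (1 / 2)" .
  qed
qed

text \<open>The number \<open>r\<close> is the order of growth of \<open>det (H\<^sup>T R\<^sup>-\<^sup>1 H)\<close>, which is \<open>q\<close> or \<open>q - 1\<close>. The three
  factors of the kernel contribute the exponents \<open>-(n - 1) / 2\<close>, \<open>r / 2\<close> and \<open>e\<close>.\<close>

lemma spiked_marginal_kernel_upper:
  fixes H :: "real^'q^'n" and a r :: real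
  defines "e \<equiv> (real CARD('n) - real CARD('q)) / 2 + a - 1"
  assumes b: "norm b = 1" and c: "0 < c" and C: "0 < C" and H: "inj ((*v) H)"
    and y: "y \<notin> span (insert b (range ((*v) H))) \<or> e \<le> 0"
    and gram: "\<exists>k>0. \<forall>s R. spiked c C b s R \<longrightarrow>
      k * s powr (- r) \<le> det (transpose H ** matrix_inv R ** H)"
  shows "\<exists>K. \<forall>s R. spiked c C b s R \<longrightarrow>
    marginal_kernel a R H y \<le> K * s powr ((r - real CARD('q)) / 2 + a - 1 / 2)"
proof -
  define n where "n = real CARD('n)"
  obtain k where k: "0 < k" "\<And>s R. spiked c C b s R \<Longrightarrow>
      k * s powr (- r) \<le> det (transpose H ** matrix_inv R ** H)"
    using gram by blast
  obtain K where K: "0 \<le> K"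
    "\<And>s R. spiked c C b s R \<Longrightarrow> S2 R H y powr (- e) \<le> K * s powr e"
    using spiked_S2_powr_upper[OF b c C H y] by blast
  let ?K = "(c ^ CARD('n)) powr (- 1 / 2) * k powr (- 1 / 2) * K"
  show ?thesis
  proof (intro exI[of _ ?K] allI impI)
    fix s R assume R: "spiked c C b s R"
    then have s: "0 < s" by (rule spikedD(2))
    have 1: "det R powr (- 1 / 2) \<le> (c ^ CARD('n)) powr (- 1 / 2) * s powr (- (n - 1) / 2)"
      using spiked_det_lower[OF b c R] c s by (intro powr_neg_half_upper) (auto simp: n_def)
    have 2: "det (transpose H ** matrix_inv R ** H) powr (- 1 / 2)
        \<le> k powr (- 1 / 2) * s powr (- (- r) / 2)"
      using k(1) s k(2)[OF R] by (rule powr_neg_half_upper)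
    have "marginal_kernel a R H y \<le>
        ((c ^ CARD('n)) powr (- 1 / 2) * s powr (- (n - 1) / 2)) *
        (k powr (- 1 / 2) * s powr (- (- r) / 2)) * (K * s powr e)"
      unfolding marginal_kernel_def unfolding e_def[symmetric]
      using 1 2 K(2)[OF R] K(1) by (intro mult_mono) auto
    also have "\<dots> = ?K * s powr (- (n - 1) / 2 + - (- r) / 2 + e)"
      by (simp add: powr_add)
    also have "- (n - 1) / 2 + - (- r) / 2 + e = (r - real CARD('q)) / 2 + a - 1 / 2"
      by (simp add: e_def n_def field_simps)
    finally show "marginal_kernel a R H y \<le> ?K * s powr ((r - real CARD('q)) / 2 + a - 1 / 2)" .
  qed
qed

section \<open>First-order expansion of the correlation matrices\<close>

lemma ones_mat_vector: "ones_mat *v v = (ones \<bullet> v) *\<^sub>R ones"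
  by (simp add: vec_eq_iff ones_mat_def ones_def matrix_vector_mult_def inner_vec_def)

lemma norm_ones: "norm (ones :: real^'n) = sqrt CARD('n)"
  by (simp add: norm_eq_sqrt_inner inner_vec_def ones_def)

lemma entry_le_max_abs_entry:
  fixes A :: "real^'m^'n"
  shows "\<bar>A $ i $ j\<bar> \<le> max_abs_entry A"
proof -
  have "{\<bar>A $ i $ j\<bar> | i j. True} = (\<lambda>(i, j). \<bar>A $ i $ j\<bar>) ` UNIV" by auto
  then have "finite {\<bar>A $ i $ j\<bar> | i j. True}" by simp
  then show ?thesis unfolding max_abs_entry_def by (rule Max_ge) blast
qed

lemma norm_matrix_vector_le:
  fixes A :: "real^'m^'n"
  shows "norm (A *v v) \<le> norm A * norm v"
proof -
  have "norm (A *v v) = L2_set (\<lambda>i. \<bar>A $ i \<bullet> v\<bar>) UNIV"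
    by (simp add: norm_vec_def matrix_vector_mul_component)
  also have "\<dots> \<le> L2_set (\<lambda>i. norm (A $ i) * norm v) UNIV"
    by (intro L2_set_mono Cauchy_Schwarz_ineq2) auto
  also have "\<dots> = norm A * norm v"
    by (simp add: norm_vec_def L2_set_left_distrib)
  finally show ?thesis .
qed

lemma abs_bilinear_form_le:
  fixes A :: "real^'m^'n"
  shows "\<bar>u \<bullet> (A *v v)\<bar> \<le> norm A * norm u * norm v"
proof -
  have "\<bar>u \<bullet> (A *v v)\<bar> \<le> norm u * norm (A *v v)" by (rule Cauchy_Schwarz_ineq2)
  also have "\<dots> \<le> norm u * (norm A * norm v)"
    by (intro mult_left_mono norm_matrix_vector_le) auto
  finally show ?thesis by (simp add: mult_ac)
qed

text \<open>The positivity of the kernel is tested on the points \<open>0\<close> and \<open>t\<close> with the weights \<open>(1, 1)\<close> and \<open>(1, -1)\<close>.\<close>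

lemma abs_correlation_function_le_1:
  assumes f: "correlation_function f" and "0 \<le> t"
  shows "\<bar>f t\<bar> \<le> 1"
proof (cases "t = 0")
  case False
  have all: "\<forall>T w. finite T \<longrightarrow> 0 \<le> (\<Sum>r\<in>T. \<Sum>s\<in>T. w r * w s * f \<bar>r - s\<bar>)" and f0: "f 0 = 1"
    using f by (simp_all add: correlation_function_def)
  have psd: "0 \<le> (\<Sum>r\<in>{0, t}. \<Sum>s\<in>{0, t}. w r * w s * f \<bar>r - s\<bar>)" for w
    by (rule all[rule_format, of "{0, t}" w]) simp
  have "0 \<le> 2 + 2 * f t" using psd[of "\<lambda>_. 1"] False \<open>0 \<le> t\<close> by (simp add: f0)
  moreover have "0 \<le> 2 - 2 * f t"
    using psd[of "\<lambda>r. if r = 0 then 1 else -1"] False \<open>0 \<le> t\<close> by (simp add: f0)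
  ultimately show ?thesis by linarith
qed (use f in \<open>simp add: correlation_function_def\<close>)

text \<open>The matrix is the kernel \<open>c0\<close> evaluated at the points \<open>x $ i $ l / g\<close>. Since these are distinct, a
  vector of coefficients indexed by \<open>i\<close> is the same as a weight function on the set of points.\<close>

lemma corr_mat_psd:
  fixes x :: "real^'p^'n"
  assumes A1: "assumption_A1 (c l)" and dist: "inj (\<lambda>i. x $ i $ l)" and g: "0 < g"
  shows "0 \<le> v \<bullet> (corr_mat c x l g *v v)"
proof -
  obtain c0 where c0: "correlation_function c0" "\<And>d. 0 \<le> d \<Longrightarrow> c l g d = c0 (d / g)"
    using A1 g unfolding assumption_A1_def by blast
  define p where "p i = x $ i $ l / g" for i
  have p: "inj p" using dist g by (auto simp: p_def inj_def)
  define w where "w t = v $ (inv p t)" for t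
  have w: "w (p i) = v $ i" for i using p by (simp add: w_def)
  have "0 \<le> (\<Sum>s\<in>range p. \<Sum>t\<in>range p. w s * w t * c0 \<bar>s - t\<bar>)"
    using c0(1) by (simp add: correlation_function_def)
  also have "\<dots> = (\<Sum>i\<in>UNIV. \<Sum>j\<in>UNIV. v $ i * v $ j * c0 \<bar>p i - p j\<bar>)"
    by (simp add: sum.reindex[OF p] w)
  also have "\<dots> = v \<bullet> (corr_mat c x l g *v v)"
    using g by (auto simp: inner_vec_def matrix_vector_mult_def corr_mat_def sum_distrib_left
        c0(2) p_def mult_ac diff_divide_distrib[symmetric] intro!: sum.cong)
  finally show ?thesis .
qed

lemma A2_scaled_tendsto:
  assumes "assumption_A2 Rl \<nu> D \<omega> Dstar B"
  shows "((\<lambda>g. (Rl g $ i $ j - 1) / \<nu> g) \<longlongrightarrow> D $ i $ j) at_top"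
proof -
  have Rl: "\<forall>\<^sub>F g in at_top. Rl g = ones_mat + \<nu> g *\<^sub>R D + (\<nu> g * \<omega> g) *\<^sub>R (Dstar + B g)"
    and \<nu>: "\<And>g. 0 < g \<Longrightarrow> 0 < \<nu> g" and \<omega>: "(\<omega> \<longlongrightarrow> 0) at_top"
    and B: "((\<lambda>g. max_abs_entry (B g)) \<longlongrightarrow> 0) at_top"
    using assms by (auto simp: assumption_A2_def)
  have "((\<lambda>g. B g $ i $ j) \<longlongrightarrow> 0) at_top"
    by (rule Lim_null_comparison[OF _ B]) (simp add: entry_le_max_abs_entry)
  then have "((\<lambda>g. D $ i $ j + \<omega> g * (Dstar $ i $ j + B g $ i $ j))
      \<longlongrightarrow> D $ i $ j + 0 * (Dstar $ i $ j + 0)) at_top"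
    by (intro tendsto_intros \<omega>)
  moreover have "\<forall>\<^sub>F g in at_top. D $ i $ j + \<omega> g * (Dstar $ i $ j + B g $ i $ j)
      = (Rl g $ i $ j - 1) / \<nu> g"
    using Rl eventually_gt_at_top[of 0]
  proof eventually_elim
    case (elim g)
    then show ?case using \<nu>[of g] by (simp add: ones_mat_def ones_def field_simps)
  qed
  ultimately show ?thesis by (simp add: Lim_transform_eventually)
qed

text \<open>Equal coordinates of two inputs would make two rows of the correlation matrix equal for every
  range parameter. This passes to the limit \<open>D\<close>, which would be singular.\<close>

lemma A2_distinct_coordinates:
  fixes x :: "real^'p^'n"
  assumes A2: "assumption_A2 (corr_mat c x l) \<nu> D \<omega> Dstar B"
  shows "inj (\<lambda>i. x $ i $ l)"
proof (rule injI, rule ccontr)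
  fix i j assume eq: "x $ i $ l = x $ j $ l" and "i \<noteq> j"
  have "D $ i $ k = D $ j $ k" for k
  proof -
    have "corr_mat c x l g $ i $ k = corr_mat c x l g $ j $ k" for g
      by (simp add: corr_mat_def eq)
    then have "((\<lambda>g. (corr_mat c x l g $ j $ k - 1) / \<nu> g) \<longlongrightarrow> D $ i $ k) at_top"
      using A2_scaled_tendsto[OF A2, of i k] by simp
    then show ?thesis
      using A2_scaled_tendsto[OF A2, of j k] by (rule tendsto_unique[rotated]) simp
  qed
  then have "det D = 0"
    using \<open>i \<noteq> j\<close> by (intro det_identical_rows[of i j]) (auto simp: row_def)
  moreover have "invertible D" using A2 by (simp add: assumption_A2_def)
  ultimately show False by (simp add: invertible_det_nz)
qed

text \<open>On vectors orthogonal to \<open>ones\<close> the leading term \<open>ones_mat\<close> vanishes, so the quadratic form of \<open>D\<close>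
  is the limit of that of the correlation matrix divided by \<open>\<nu>\<close>.\<close>

lemma A2_psd_on_contrasts:
  assumes A2: "assumption_A2 Rl \<nu> D \<omega> Dstar B"
    and psd: "\<And>g v. 0 < g \<Longrightarrow> 0 \<le> v \<bullet> (Rl g *v v)" and v: "ones \<bullet> v = 0"
  shows "0 \<le> v \<bullet> (D *v v)"
proof -
  define M where "M g = (\<chi> i j. (Rl g $ i $ j - 1) / \<nu> g)" for g
  have "(M \<longlongrightarrow> (\<chi> i j. D $ i $ j)) at_top"
    unfolding M_def by (intro tendsto_vec_lambda A2_scaled_tendsto[OF A2])
  then have "((\<lambda>g. v \<bullet> (M g *v v)) \<longlongrightarrow> v \<bullet> (D *v v)) at_top"
    by (intro tendsto_inner tendsto_const tendsto_matrix_vector_mult) simp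
  moreover have "\<forall>\<^sub>F g in at_top. 0 \<le> v \<bullet> (M g *v v)"
    using eventually_gt_at_top[of 0]
  proof eventually_elim
    case (elim g)
    have "M g = (1 / \<nu> g) *\<^sub>R (Rl g - ones_mat)"
      by (simp add: M_def vec_eq_iff ones_mat_def ones_def)
    then have "v \<bullet> (M g *v v) = (1 / \<nu> g) * (v \<bullet> (Rl g *v v))"
      using v by (simp add: scaleR_matrix_vector_assoc[symmetric] matrix_vector_mult_diff_rdistrib
          inner_diff_right ones_mat_vector)
    moreover have "0 < \<nu> g" using A2 elim by (simp add: assumption_A2_def)
    ultimately show ?case using psd[OF elim, of v] by simp
  qed
  ultimately show ?thesis by (rule tendsto_lowerbound) simp
qed

text \<open>A vector \<open>v\<close> of the hyperplane at which the form vanishes minimises it there, so \<open>D v\<close> is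
  orthogonal to the hyperplane, that is, \<open>D v\<close> is a multiple of \<open>b\<close>. Hence \<open>v\<close> is a multiple of \<open>D\<^sup>-\<^sup>1 b\<close>,
  and \<open>b\<^sup>T v = 0\<close> together with \<open>b\<^sup>T D\<^sup>-\<^sup>1 b \<noteq> 0\<close> forces \<open>v = 0\<close>.\<close>

lemma pos_on_hyperplane_if_psd:
  fixes D :: "real^'n^'n"
  assumes b: "norm b = 1" and sym: "transpose D = D" and inv: "invertible D"
    and bDb: "b \<bullet> (matrix_inv D *v b) \<noteq> 0"
    and psd: "\<And>v. b \<bullet> v = 0 \<Longrightarrow> 0 \<le> v \<bullet> (D *v v)"
    and v: "b \<bullet> v = 0" "v \<noteq> 0"
  shows "0 < v \<bullet> (D *v v)"
proof (rule ccontr)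
  assume "\<not> 0 < v \<bullet> (D *v v)"
  then have v0: "v \<bullet> (D *v v) = 0" using psd[OF v(1)] by simp
  have comm: "u \<bullet> (D *v w) = w \<bullet> (D *v u)" for u w
    by (metis sym inner_commute inner_matrix_vector)
  have ortho: "w \<bullet> (D *v v) = 0" if w: "b \<bullet> w = 0" for w
  proof (rule ccontr)
    define p r where "p = w \<bullet> (D *v v)" and "r = w \<bullet> (D *v w)"
    assume "w \<bullet> (D *v v) \<noteq> 0"
    then have p: "p \<noteq> 0" by (simp add: p_def)
    have r: "0 \<le> r" using psd[OF w] by (simp add: r_def)
    \<comment> \<open>a short step against the slope \<open>p\<close>; the added \<open>1\<close> covers the case \<open>r = 0\<close>\<close>
    define t where "t = - p / (r + 1)"
    have p_eq: "p = - t * (r + 1)" using r by (simp add: t_def)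
    have "0 \<le> (v + t *\<^sub>R w) \<bullet> (D *v (v + t *\<^sub>R w))"
      using v w by (intro psd) (simp add: inner_add_right)
    also have "\<dots> = 2 * t * p + t\<^sup>2 * r"
      by (simp add: matrix_vector_right_distrib matrix_vector_mult_scaleR inner_add_left
          inner_add_right v0 comm[of v w] power2_eq_square algebra_simps flip: p_def r_def)
    also have "\<dots> = - (t\<^sup>2 * (r + 2))"
      unfolding p_eq by (simp add: power2_eq_square algebra_simps)
    also have "\<dots> < 0" using p r by (simp add: t_def)
    finally show False by simp
  qed
  have "(norm (reject b (D *v v)))\<^sup>2 = 0"
    using ortho[OF reject_orthogonal[OF b]] by (simp add: inner_commute flip: inner_reject[OF b])
  then have "D *v v = (b \<bullet> (D *v v)) *\<^sub>R b" by (simp add: reject_def)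
  then have *: "v = (b \<bullet> (D *v v)) *\<^sub>R (matrix_inv D *v b)"
    by (metis matrix_inv_vector_cancel(2)[OF inv] matrix_vector_mult_scaleR)
  then have "(b \<bullet> (D *v v)) * (b \<bullet> (matrix_inv D *v b)) = 0"
    using v(1) by (metis inner_scaleR_right)
  then show False using bDb * v(2) by auto
qed

text \<open>The minimum over the compact unit sphere of the hyperplane is attained and positive.\<close>

lemma coercive_on_hyperplane:
  fixes D :: "real^'n^'n"
  assumes pos: "\<And>v. b \<bullet> v = 0 \<Longrightarrow> v \<noteq> 0 \<Longrightarrow> 0 < v \<bullet> (D *v v)"
  shows "\<exists>m>0. \<forall>v. b \<bullet> v = 0 \<longrightarrow> m * (norm v)\<^sup>2 \<le> v \<bullet> (D *v v)"
proof (cases "\<exists>v. b \<bullet> v = 0 \<and> v \<noteq> 0")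
  case True
  let ?S = "sphere 0 1 \<inter> {v. b \<bullet> v = 0}"
  obtain v0 where "b \<bullet> v0 = 0" "v0 \<noteq> 0" using True by blast
  then have "(1 / norm v0) *\<^sub>R v0 \<in> ?S" by simp
  then have ne: "?S \<noteq> {}" by blast
  have cpt: "compact ?S" by (intro compact_Int_closed compact_sphere closed_hyperplane)
  have "continuous_on ?S (\<lambda>v. v \<bullet> (D *v v))"
    by (intro continuous_intros matrix_vector_mult_linear_continuous_on)
  then obtain u where u: "u \<in> ?S" "\<And>v. v \<in> ?S \<Longrightarrow> u \<bullet> (D *v u) \<le> v \<bullet> (D *v v)"
    using continuous_attains_inf[OF cpt ne] by blast
  show ?thesis
  proof (intro exI[of _ "u \<bullet> (D *v u)"] conjI allI impI)
    show "0 < u \<bullet> (D *v u)" using u(1) by (intro pos) auto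
    fix v assume v: "b \<bullet> v = 0"
    show "u \<bullet> (D *v u) * (norm v)\<^sup>2 \<le> v \<bullet> (D *v v)"
    proof (cases "v = 0")
      case False
      have "u \<bullet> (D *v u) \<le> ((1 / norm v) *\<^sub>R v) \<bullet> (D *v ((1 / norm v) *\<^sub>R v))"
        using v False by (intro u(2)) simp
      also have "\<dots> = v \<bullet> (D *v v) / (norm v)\<^sup>2"
        by (simp add: matrix_vector_mult_scaleR power2_eq_square)
      finally show ?thesis using False by (simp add: field_simps)
    qed simp
  qed
\<comment> \<open>if the hyperplane is trivial, any constant will do\<close>
qed (auto intro!: exI[of _ 1])

text \<open>The error is measured against the sum of all \<open>\<nu>\<close>, since nothing is known about their relative
  sizes. The induction over the factors works because each quotient of a single \<open>\<nu>\<close> by this sum is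
  bounded by \<open>1\<close>.\<close>

lemma prod_one_plus_first_order:
  fixes \<nu> E :: "'p::finite \<Rightarrow> 'a \<Rightarrow> real"
  assumes pos: "\<forall>\<^sub>F t in F. \<forall>l. 0 < \<nu> l t" and \<nu>: "\<And>l. (\<nu> l \<longlongrightarrow> 0) F"
    and E: "\<And>l. (E l \<longlongrightarrow> d l) F"
  shows "((\<lambda>t. ((\<Prod>l\<in>UNIV. 1 + \<nu> l t * E l t) - 1 - (\<Sum>l\<in>UNIV. \<nu> l t * d l)) / (\<Sum>l\<in>UNIV. \<nu> l t))
    \<longlongrightarrow> 0) F"
proof -
  define s where "s t = (\<Sum>l\<in>UNIV. \<nu> l t)" for t
  define P where "P A t = (\<Prod>l\<in>A. 1 + \<nu> l t * E l t)" for A t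
  have P1: "(P A \<longlongrightarrow> 1) F" for A
  proof -
    have "(P A \<longlongrightarrow> (\<Prod>l\<in>A. 1 + 0 * d l)) F"
      unfolding P_def by (intro tendsto_intros \<nu> E)
    then show ?thesis by simp
  qed
  have "((\<lambda>t. (P A t - 1 - (\<Sum>l\<in>A. \<nu> l t * d l)) / s t) \<longlongrightarrow> 0) F" if "finite A" for A
    using that
  proof induction
    case (insert m A)
    have "((\<lambda>t. E m t * P A t - d m) \<longlongrightarrow> d m * 1 - d m) F"
      by (intro tendsto_intros E P1)
    then have *: "((\<lambda>t. \<bar>E m t * P A t - d m\<bar>) \<longlongrightarrow> 0) F"
      using tendsto_rabs_zero by force
    have "((\<lambda>t. \<nu> m t / s t * (E m t * P A t - d m)) \<longlongrightarrow> 0) F"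
    proof (rule Lim_null_comparison[OF _ *])
      show "\<forall>\<^sub>F t in F. norm (\<nu> m t / s t * (E m t * P A t - d m)) \<le> \<bar>E m t * P A t - d m\<bar>"
        using pos
      proof eventually_elim
        case (elim t)
        have "\<nu> m t \<le> s t"
          unfolding s_def using elim by (intro member_le_sum) (auto simp: less_imp_le)
        then have "\<bar>\<nu> m t / s t\<bar> \<le> 1" using elim[rule_format, of m] by simp
        then show ?case by (simp only: real_norm_def abs_mult mult_left_le_one_le abs_ge_zero)
      qed
    qed
    with insert have "((\<lambda>t. (P A t - 1 - (\<Sum>l\<in>A. \<nu> l t * d l)) / s t +
        \<nu> m t / s t * (E m t * P A t - d m)) \<longlongrightarrow> 0 + 0) F"
      by (intro tendsto_add)
    moreover have "(P A t - 1 - (\<Sum>l\<in>A. \<nu> l t * d l)) / s t + \<nu> m t / s t * (E m t * P A t - d m)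
        = (P (insert m A) t - 1 - (\<Sum>l\<in>insert m A. \<nu> l t * d l)) / s t" for t
      using insert.hyps by (simp add: P_def add_divide_distrib[symmetric]) (simp add: algebra_simps)
    ultimately show ?case by simp
  qed (simp add: P_def)
  from this[of UNIV] show ?thesis by (simp add: P_def s_def)
qed

text \<open>Write \<open>v = \<alpha> b + w\<close> with \<open>w\<close> orthogonal to \<open>b\<close>. The form of \<open>G\<close> is at least \<open>m s \<parallel>w\<parallel>\<^sup>2\<close> on \<open>w\<close>; its
  cross terms are of size \<open>K s \<bar>\<alpha>\<bar> \<parallel>w\<parallel>\<close> and are split by completing the square, half of the
  \<open>w\<close>-part absorbing them at the price of a multiple of \<open>s \<alpha>\<^sup>2\<close>. For small \<open>s\<close> the term \<open>\<kappa> \<alpha>\<^sup>2\<close> pays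
  for that.\<close>

lemma spiked_of_perturbation:
  fixes R G :: "real^'n^'n"
  assumes b: "norm b = 1" and pd: "pos_def R" and \<kappa>: "1 \<le> \<kappa>" and m: "0 < m" and K: "0 \<le> K"
    and s: "0 < s" "s \<le> 1" "s * (K + 2 * K\<^sup>2 / m) \<le> 1 / 2"
    and R: "\<And>v. v \<bullet> (R *v v) = \<kappa> * (b \<bullet> v)\<^sup>2 + v \<bullet> (G *v v)"
    and G: "\<And>u v. \<bar>u \<bullet> (G *v v)\<bar> \<le> K * s * norm u * norm v"
    and G_low: "\<And>v. b \<bullet> v = 0 \<Longrightarrow> m * s * (norm v)\<^sup>2 \<le> v \<bullet> (G *v v)"
  shows "spiked (min (1 / 2) (m / 2)) (\<kappa> + K) b s R"
  unfolding spiked_def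
proof (intro conjI allI impI pd s(1,2))
  have Gvv: "v \<bullet> (G *v v) \<le> K * s * (norm v)\<^sup>2" for v
    using G[of v v] by (simp add: power2_eq_square mult.assoc)
  have bv: "(b \<bullet> v)\<^sup>2 \<le> (norm v)\<^sup>2" for v using norm_reject[OF b, of v] by simp
  fix v :: "real^'n"
  have "K * s * (norm v)\<^sup>2 \<le> K * (norm v)\<^sup>2"
    using K s by (intro mult_right_mono mult_left_le) auto
  moreover have "\<kappa> * (b \<bullet> v)\<^sup>2 \<le> \<kappa> * (norm v)\<^sup>2" using \<kappa> bv[of v] by (intro mult_left_mono) auto
  ultimately show "v \<bullet> (R *v v) \<le> (\<kappa> + K) * (norm v)\<^sup>2"
    using R[of v] Gvv[of v] by (simp add: distrib_right)
  show "v \<bullet> (R *v v) \<le> (\<kappa> + K) * s * (norm v)\<^sup>2" if "b \<bullet> v = 0"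
  proof -
    have "0 \<le> \<kappa> * s * (norm v)\<^sup>2" using \<kappa> s by simp
    then show ?thesis using that R[of v] Gvv[of v] by (simp add: distrib_right)
  qed
  define w where "w = reject b v"
  define \<alpha> where "\<alpha> = b \<bullet> v"
  define \<delta> where "\<delta> = norm w"
  have v: "v = \<alpha> *\<^sub>R b + w" by (simp add: \<alpha>_def w_def reject_def)
  have bw: "b \<bullet> w = 0" unfolding w_def by (rule reject_orthogonal[OF b])
  have "v \<bullet> (G *v v) = \<alpha>\<^sup>2 * (b \<bullet> (G *v b)) + \<alpha> * (b \<bullet> (G *v w)) + \<alpha> * (w \<bullet> (G *v b)) + w \<bullet> (G *v w)"
    unfolding v by (simp add: matrix_vector_right_distrib matrix_vector_mult_scaleR inner_add_left
        inner_add_right power2_eq_square algebra_simps)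
  moreover have "- (\<alpha>\<^sup>2 * (K * s)) \<le> \<alpha>\<^sup>2 * (b \<bullet> (G *v b))"
  proof -
    have "\<alpha>\<^sup>2 * (- (K * s)) \<le> \<alpha>\<^sup>2 * (b \<bullet> (G *v b))"
      using G[of b b] b by (intro mult_left_mono) auto
    then show ?thesis by simp
  qed
  moreover have "- (\<bar>\<alpha>\<bar> * (K * s * \<delta>)) \<le> \<alpha> * z" if "\<bar>z\<bar> \<le> K * s * \<delta>" for z
  proof -
    have "\<bar>\<alpha> * z\<bar> \<le> \<bar>\<alpha>\<bar> * (K * s * \<delta>)"
      unfolding abs_mult using that by (intro mult_left_mono) auto
    then show ?thesis by linarith
  qed
  then have "- (\<bar>\<alpha>\<bar> * (K * s * \<delta>)) \<le> \<alpha> * (b \<bullet> (G *v w))"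
    "- (\<bar>\<alpha>\<bar> * (K * s * \<delta>)) \<le> \<alpha> * (w \<bullet> (G *v b))"
    using G[of b w] G[of w b] b by (simp_all add: \<delta>_def)
  moreover have "m * s * \<delta>\<^sup>2 \<le> w \<bullet> (G *v w)" using G_low[OF bw] by (simp add: \<delta>_def)
  moreover have "2 * (\<bar>\<alpha>\<bar> * (K * s * \<delta>)) \<le> m / 2 * s * \<delta>\<^sup>2 + s * (2 * K\<^sup>2 / m) * \<alpha>\<^sup>2"
  proof -
    have "0 \<le> s * (m / 2) * (\<delta> - 2 * K / m * \<bar>\<alpha>\<bar>)\<^sup>2" using s m by simp
    also have "\<dots> = m / 2 * s * \<delta>\<^sup>2 + s * (2 * K\<^sup>2 / m) * \<alpha>\<^sup>2 - 2 * (\<bar>\<alpha>\<bar> * (K * s * \<delta>))"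
      using m by (simp add: power2_diff power_mult_distrib power_divide field_simps)
        (simp add: power2_eq_square)
    finally show ?thesis by simp
  qed
  moreover have "m * s * \<delta>\<^sup>2 = m / 2 * s * \<delta>\<^sup>2 + m / 2 * (s * \<delta>\<^sup>2)" by simp
  moreover have "k - (p + t) + z' \<le> k + g"
    if "g = a1 + a2 + a3 + a4" "- p \<le> a1" "- q \<le> a2" "- q \<le> a3" "y \<le> a4"
      "2 * q \<le> z + t" "y = z + z'" for k g a1 a2 a3 a4 p q t y z z' :: real
    using that by linarith
  ultimately have "\<kappa> * \<alpha>\<^sup>2 - (\<alpha>\<^sup>2 * (K * s) + s * (2 * K\<^sup>2 / m) * \<alpha>\<^sup>2) + m / 2 * (s * \<delta>\<^sup>2)
      \<le> \<kappa> * \<alpha>\<^sup>2 + v \<bullet> (G *v v)"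
    by blast
  moreover have "\<alpha>\<^sup>2 * (K * s) + s * (2 * K\<^sup>2 / m) * \<alpha>\<^sup>2 = s * (K + 2 * K\<^sup>2 / m) * \<alpha>\<^sup>2"
    by (simp add: algebra_simps)
  ultimately have "\<kappa> * \<alpha>\<^sup>2 - s * (K + 2 * K\<^sup>2 / m) * \<alpha>\<^sup>2 + m / 2 * (s * \<delta>\<^sup>2) \<le> v \<bullet> (R *v v)"
    unfolding R[of v] \<alpha>_def[symmetric] by metis
  moreover have "s * (K + 2 * K\<^sup>2 / m) * \<alpha>\<^sup>2 \<le> 1 / 2 * \<alpha>\<^sup>2" by (intro mult_right_mono s) auto
  moreover have "1 * \<alpha>\<^sup>2 \<le> \<kappa> * \<alpha>\<^sup>2" using \<kappa> by (intro mult_right_mono) auto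
  ultimately have "1 / 2 * \<alpha>\<^sup>2 + m / 2 * (s * \<delta>\<^sup>2) \<le> v \<bullet> (R *v v)" by simp
  moreover have "min (1 / 2) (m / 2) * \<alpha>\<^sup>2 \<le> 1 / 2 * \<alpha>\<^sup>2"
    "min (1 / 2) (m / 2) * (s * \<delta>\<^sup>2) \<le> m / 2 * (s * \<delta>\<^sup>2)"
    using s by (intro mult_right_mono; simp)+
  ultimately show "min (1 / 2) (m / 2) * ((b \<bullet> v)\<^sup>2 + s * (norm (reject b v))\<^sup>2) \<le> v \<bullet> (R *v v)"
    unfolding \<alpha>_def[symmetric] w_def[symmetric] \<delta>_def[symmetric] distrib_left by linarith
qed

section \<open>Almost every realization is in general position\<close>

lemma column_space_eq_range:
  fixes H :: "real^'q^'n"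
  shows "column_space H = range ((*v) H)"
proof
  have "columns H \<subseteq> range ((*v) H)" by (auto simp: columns_image_basis)
  moreover have "subspace (range ((*v) H))"
    by (intro linear_subspace_image) auto
  ultimately show "column_space H \<subseteq> range ((*v) H)"
    unfolding column_space_def by (rule span_minimal)
qed (auto simp: column_space_def matrix_vector_mult_in_columnspace)

lemma AE_mvn_notin_proper_subspace:
  fixes S :: "(real^'n) set"
  assumes S: "subspace S" "dim S < CARD('n)"
  shows "AE y in mvn \<mu> \<Sigma>. y \<notin> S"
proof -
  have "S \<in> null_sets lebesgue"
    using negligible_lowdim[of S] S by (simp add: negligible_iff_null_sets)
  moreover have "S \<in> sets borel" using closed_subspace[OF S(1)] by simp
  ultimately have "S \<in> null_sets lborel"
    using null_sets_completion_iff[of S lborel] by simp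
  then have "AE y in lborel. y \<notin> S" by (rule AE_not_in)
  moreover have "(\<lambda>y. ennreal (mvn_density \<mu> \<Sigma> y)) \<in> borel_measurable lborel"
  proof -
    have "continuous_on UNIV (\<lambda>y. exp (- ((y - \<mu>) \<bullet> (matrix_inv \<Sigma> *v (y - \<mu>))) / 2))"
      by (intro continuous_intros continuous_on_compose2[OF matrix_vector_mult_linear_continuous_on])
        auto
    then have "(\<lambda>y. exp (- ((y - \<mu>) \<bullet> (matrix_inv \<Sigma> *v (y - \<mu>))) / 2)) \<in> borel_measurable borel"
      by (rule borel_measurable_continuous_onI)
    then show ?thesis unfolding mvn_density_def by measurable
  qed
  ultimately show ?thesis unfolding mvn_def by (subst AE_density) auto
qed

lemma dim_range_matrix_vector_le:
  fixes H :: "real^'q^'n"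
  shows "dim (range ((*v) H)) \<le> CARD('q)"
  using dim_image_le[of "(*v) H" UNIV] by simp

section \<open>Correlation matrices in the limit of the range parameters\<close>

lemma filterlim_param_all_to_infinity:
  "filterlim (\<lambda>\<gamma>. \<gamma> $ l) at_top all_params_to_infinity"
  unfolding all_params_to_infinity_def
  by (rule filterlim_mono[OF filterlim_filtercomap order_refl
        INF_lower[where f = "\<lambda>l. filtercomap (\<lambda>\<gamma>. \<gamma> $ l) at_top"]]) simp

lemma eventually_pos_params_at_infinity:
  "\<forall>\<^sub>F \<gamma> :: real^'p in all_params_to_infinity. \<gamma> \<in> pos_params"
proof -
  have "\<forall>\<^sub>F \<gamma> :: real^'p in all_params_to_infinity. 0 < \<gamma> $ l" for l
    using filterlim_param_all_to_infinity[of l] unfolding filterlim_at_top_dense by blast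
  then show ?thesis by (simp add: pos_params_def eventually_all_finite)
qed

lemma eventually_pos_params_one_to_zero: "\<forall>\<^sub>F \<gamma> in one_param_to_zero l. \<gamma> \<in> pos_params"
  by (simp add: one_param_to_zero_def eventually_inf_principal)

lemma filterlim_one_param_to_zero: "filterlim (\<lambda>\<gamma>. \<gamma> $ l) (at_right 0) (one_param_to_zero l)"
  unfolding one_param_to_zero_def
  by (rule filterlim_mono[OF filterlim_filtercomap order_refl inf_le1])

lemma abs_corr_mat_le_1:
  assumes "assumption_A1 (c l)" "0 < g"
  shows "\<bar>corr_mat c x l g $ i $ j\<bar> \<le> 1"
proof -
  obtain c0 where c0: "correlation_function c0" "\<And>d. 0 \<le> d \<Longrightarrow> c l g d = c0 (d / g)"
    using assms unfolding assumption_A1_def by blast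
  then show ?thesis
    using abs_correlation_function_le_1[OF c0(1)] assms(2) by (simp add: corr_mat_def)
qed

text \<open>One vanishing factor suffices for an off-diagonal entry of the Hadamard product to vanish, as
  the other factors are bounded by \<open>1\<close>, whatever their range parameters do.\<close>

lemma prod_corr_mat_tendsto_identity:
  fixes x :: "real^'p^'n"
  assumes A1: "\<And>l. assumption_A1 (c l)" and dist: "inj (\<lambda>i. x $ i $ l)"
  shows "(prod_corr_mat c x \<longlongrightarrow> mat 1) (one_param_to_zero l)"
proof -
  have "((\<lambda>\<gamma>. prod_corr_mat c x \<gamma> $ i $ j) \<longlongrightarrow> mat 1 $ i $ j) (one_param_to_zero l)" for i j
  proof (cases "i = j")
    case True
    have "prod_corr_mat c x \<gamma> $ i $ j = 1" if "\<gamma> \<in> pos_params" for \<gamma>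
    proof -
      have "corr_mat c x k (\<gamma> $ k) $ i $ j = 1" for k
      proof -
        obtain c0 where "correlation_function c0" "\<And>g d. 0 < g \<Longrightarrow> 0 \<le> d \<Longrightarrow> c k g d = c0 (d / g)"
          using A1[of k] unfolding assumption_A1_def by blast
        then show ?thesis
          using that True by (simp add: corr_mat_def pos_params_def correlation_function_def)
      qed
      then show ?thesis by (simp add: prod_corr_mat_def)
    qed
    then have "\<forall>\<^sub>F \<gamma> in one_param_to_zero l. prod_corr_mat c x \<gamma> $ i $ j = 1"
      using eventually_pos_params_one_to_zero by (rule eventually_mono[rotated])
    then show ?thesis using True by (simp add: mat_def tendsto_eventually)
  next
    case False
    define d where "d = \<bar>x $ i $ l - x $ j $ l\<bar>"
    have d: "0 < d" using False dist by (auto simp: d_def inj_def)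
    obtain c0 where c0: "(c0 \<longlongrightarrow> 0) at_top" "\<And>g d. 0 < g \<Longrightarrow> 0 \<le> d \<Longrightarrow> c l g d = c0 (d / g)"
      using A1[of l] unfolding assumption_A1_def by blast
    have "filterlim (\<lambda>t. d * inverse t) at_top (at_right 0)"
      using d filterlim_inverse_at_top_right
      by (intro filterlim_tendsto_pos_mult_at_top[OF tendsto_const])
    then have "filterlim (\<lambda>\<gamma>. d * inverse (\<gamma> $ l)) at_top (one_param_to_zero l)"
      using filterlim_one_param_to_zero[of l] by (rule filterlim_compose)
    then have "((\<lambda>\<gamma>. c0 (d * inverse (\<gamma> $ l))) \<longlongrightarrow> 0) (one_param_to_zero l)"
      using c0(1) by (rule filterlim_compose[rotated])
    then have lim: "((\<lambda>\<gamma>. \<bar>c0 (d * inverse (\<gamma> $ l))\<bar>) \<longlongrightarrow> 0) (one_param_to_zero l)"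
      by (rule tendsto_rabs_zero)
    have "((\<lambda>\<gamma>. prod_corr_mat c x \<gamma> $ i $ j) \<longlongrightarrow> 0) (one_param_to_zero l)"
    proof (rule Lim_null_comparison[OF _ lim])
      show "\<forall>\<^sub>F \<gamma> in one_param_to_zero l.
          norm (prod_corr_mat c x \<gamma> $ i $ j) \<le> \<bar>c0 (d * inverse (\<gamma> $ l))\<bar>"
        using eventually_pos_params_one_to_zero
      proof eventually_elim
        case (elim \<gamma>)
        then have \<gamma>: "0 < \<gamma> $ k" for k by (simp add: pos_params_def)
        have "\<bar>prod_corr_mat c x \<gamma> $ i $ j\<bar> = \<bar>corr_mat c x l (\<gamma> $ l) $ i $ j\<bar> *
            (\<Prod>k\<in>UNIV - {l}. \<bar>corr_mat c x k (\<gamma> $ k) $ i $ j\<bar>)"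
          by (simp add: prod_corr_mat_def prod.remove[of UNIV l] abs_mult abs_prod)
        also have "\<dots> \<le> \<bar>corr_mat c x l (\<gamma> $ l) $ i $ j\<bar> * 1"
          using abs_corr_mat_le_1[OF A1 \<gamma>] by (intro mult_left_mono prod_le_1) auto
        also have "\<dots> = \<bar>c0 (d * inverse (\<gamma> $ l))\<bar>"
          using d by (simp add: corr_mat_def c0(2)[OF \<gamma>] d_def divide_inverse)
        finally show ?case by simp
      qed
    qed
    then show ?thesis using False by (simp add: mat_def)
  qed
  then show ?thesis by (intro vec_tendstoI)
qed

lemma pos_def_mat_1: "pos_def (mat 1 :: real^'n^'n)"
  by (simp add: pos_def_def)

definition unit_ones :: "real^'n" where
  "unit_ones = (1 / sqrt CARD('n)) *\<^sub>R ones"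

lemma norm_unit_ones: "norm (unit_ones :: real^'n) = 1"
  by (simp add: unit_ones_def norm_ones)

lemma ones_eq: "(ones :: real^'n) = sqrt CARD('n) *\<^sub>R unit_ones"
  by (simp add: unit_ones_def)

lemma unit_ones_in_range_iff:
  fixes H :: "real^'q^'n"
  shows "unit_ones \<in> range ((*v) H) \<longleftrightarrow> ones \<in> range ((*v) H)"
proof -
  have "subspace (range ((*v) H))" by (intro linear_subspace_image) auto
  then show ?thesis
    using subspace_scale[of "range ((*v) H)"] ones_eq[where 'n='n] unit_ones_def[where 'n='n]
    by metis
qed

lemma A2_coercive_on_contrasts:
  fixes x :: "real^'p^'n"
  assumes A1: "assumption_A1 (c l)"
    and A2: "assumption_A2 (corr_mat c x l) \<nu> D \<omega> Dstar B"
  shows "\<exists>m>0. \<forall>v. unit_ones \<bullet> v = 0 \<longrightarrow> m * (norm v)\<^sup>2 \<le> v \<bullet> (D *v v)"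
proof (rule coercive_on_hyperplane, rule pos_on_hyperplane_if_psd[OF norm_unit_ones])
  show "transpose D = D" "invertible D" using A2 by (auto simp: assumption_A2_def)
  show "unit_ones \<bullet> (matrix_inv D *v unit_ones) \<noteq> 0"
    using A2 by (simp add: assumption_A2_def unit_ones_def matrix_vector_mult_scaleR)
  fix v :: "real^'n" assume "unit_ones \<bullet> v = 0"
  then show "0 \<le> v \<bullet> (D *v v)"
    by (intro A2_psd_on_contrasts[OF A2] corr_mat_psd[where c = c and x = x and l = l]
        A1 A2_distinct_coordinates[OF A2])
      (auto simp: ones_eq)
qed

lemma tendsto_norm_zero_if_entries:
  fixes N :: "'a \<Rightarrow> real^'m^'n"
  assumes "\<And>i j. ((\<lambda>t. N t $ i $ j) \<longlongrightarrow> 0) F"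
  shows "((\<lambda>t. norm (N t)) \<longlongrightarrow> 0) F"
  using assms by (intro tendsto_norm_zero vec_tendstoI) simp

text \<open>With \<open>T = \<Sum>\<^sub>l \<nu>\<^sub>l D\<^sub>l\<close> and \<open>s = \<Sum>\<^sub>l \<nu>\<^sub>l\<close>, the first-order expansion of the entries reads
  \<open>R = ones_mat + T + s N\<close> with \<open>N \<rightarrow> 0\<close>. On the contrasts \<open>T\<close> is bounded below by \<open>s\<close> times the least of
  the coercivity constants of the \<open>D\<^sub>l\<close>, and \<open>N\<close> takes away at most half of this.\<close>

lemma prod_corr_mat_eventually_spiked:
  fixes x :: "real^'p^'n"
  assumes pd: "\<And>\<gamma>. \<gamma> \<in> pos_params \<Longrightarrow> pos_def (prod_corr_mat c x \<gamma>)"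
    and A1: "\<And>l. assumption_A1 (c l)"
    and A2: "\<And>l. assumption_A2 (corr_mat c x l) (\<nu> l) (D l) (\<omega> l) (Dstar l) (B l)"
  shows "\<exists>k>0. \<exists>C>0. \<forall>\<^sub>F \<gamma> in all_params_to_infinity.
    spiked k C unit_ones (\<Sum>l\<in>UNIV. \<nu> l (\<gamma> $ l)) (prod_corr_mat c x \<gamma>)"
proof -
  define R where "R = prod_corr_mat c x"
  define s where "s \<gamma> = (\<Sum>l\<in>UNIV. \<nu> l (\<gamma> $ l))" for \<gamma> :: "real^'p"
  define G where "G \<gamma> = R \<gamma> - ones_mat" for \<gamma>
  define T where "T \<gamma> = (\<Sum>l\<in>UNIV. \<nu> l (\<gamma> $ l) *\<^sub>R D l)" for \<gamma> :: "real^'p"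
  define N where "N \<gamma> = (1 / s \<gamma>) *\<^sub>R (G \<gamma> - T \<gamma>)" for \<gamma>
  let ?F = "all_params_to_infinity :: (real^'p) filter"
  have \<nu>_pos: "0 < \<nu> l (\<gamma> $ l)" if "\<gamma> \<in> pos_params" for \<gamma> l
    using A2[of l] that by (simp add: assumption_A2_def pos_params_def)
  have \<nu>_lim: "((\<lambda>\<gamma>. \<nu> l (\<gamma> $ l)) \<longlongrightarrow> 0) ?F" for l
    using A2[of l] filterlim_param_all_to_infinity[of l]
    by (auto simp: assumption_A2_def intro: filterlim_compose)
  have ev_\<nu>: "\<forall>\<^sub>F \<gamma> in ?F. \<forall>l. 0 < \<nu> l (\<gamma> $ l)"
    using eventually_pos_params_at_infinity by eventually_elim (use \<nu>_pos in blast)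
  have T_entry: "T \<gamma> $ i $ j = (\<Sum>l\<in>UNIV. \<nu> l (\<gamma> $ l) * D l $ i $ j)" for \<gamma> i j
    by (simp add: T_def)
  have "((\<lambda>\<gamma>. N \<gamma> $ i $ j) \<longlongrightarrow> 0) ?F" for i j
  proof -
    define E where "E l \<gamma> = (corr_mat c x l (\<gamma> $ l) $ i $ j - 1) / \<nu> l (\<gamma> $ l)"
      for l and \<gamma> :: "real^'p"
    have E: "(E l \<longlongrightarrow> D l $ i $ j) ?F" for l
      unfolding E_def
      by (rule filterlim_compose[OF A2_scaled_tendsto[OF A2] filterlim_param_all_to_infinity])
    have lim: "((\<lambda>\<gamma>. ((\<Prod>l\<in>UNIV. 1 + \<nu> l (\<gamma> $ l) * E l \<gamma>) - 1
        - (\<Sum>l\<in>UNIV. \<nu> l (\<gamma> $ l) * D l $ i $ j)) / (\<Sum>l\<in>UNIV. \<nu> l (\<gamma> $ l))) \<longlongrightarrow> 0) ?F"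
      by (rule prod_one_plus_first_order[OF ev_\<nu> \<nu>_lim E])
    have "\<forall>\<^sub>F \<gamma> in ?F. ((\<Prod>l\<in>UNIV. 1 + \<nu> l (\<gamma> $ l) * E l \<gamma>) - 1
        - (\<Sum>l\<in>UNIV. \<nu> l (\<gamma> $ l) * D l $ i $ j)) / (\<Sum>l\<in>UNIV. \<nu> l (\<gamma> $ l)) = N \<gamma> $ i $ j"
      using ev_\<nu>
    proof eventually_elim
      case (elim \<gamma>)
      then have "1 + \<nu> l (\<gamma> $ l) * E l \<gamma> = corr_mat c x l (\<gamma> $ l) $ i $ j" for l
        using less_imp_neq[OF elim[rule_format, of l]] by (simp add: E_def)
      then show ?case
        by (simp add: N_def G_def T_entry R_def prod_corr_mat_def ones_mat_def ones_def s_def)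
    qed
    with lim show ?thesis by (rule Lim_transform_eventually)
  qed
  then have N_lim: "((\<lambda>\<gamma>. norm (N \<gamma>)) \<longlongrightarrow> 0) ?F" by (rule tendsto_norm_zero_if_entries)
  have "\<forall>l. \<exists>m>0. \<forall>v. unit_ones \<bullet> v = 0 \<longrightarrow> m * (norm v)\<^sup>2 \<le> v \<bullet> (D l *v v)"
    using A2_coercive_on_contrasts[OF A1 A2] by blast
  then obtain m where m: "\<And>l. 0 < m l"
    "\<And>l v. unit_ones \<bullet> v = 0 \<Longrightarrow> m l * (norm v)\<^sup>2 \<le> v \<bullet> (D l *v v)" by metis
  \<comment> \<open>the factor \<open>1 / 2\<close> leaves room for the error matrix \<open>N\<close>, and the \<open>1\<close> added in \<open>K\<close> bounds its norm\<close>
  define m0 where "m0 = Min (range m) / 2"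
  have m0: "0 < m0" and m0_le: "2 * m0 \<le> m l" for l
    using m(1) by (auto simp: m0_def)
  define K where "K = (\<Sum>l\<in>UNIV. norm (D l)) + 1"
  have K: "0 \<le> K" by (simp add: K_def sum_nonneg add_nonneg_nonneg)
  \<comment> \<open>both smallness conditions on \<open>s\<close> hold below \<open>\<delta>\<close>; the added \<open>1\<close> keeps the denominator positive\<close>
  define \<delta> where "\<delta> = min 1 (1 / (2 * (K + 2 * K\<^sup>2 / m0 + 1)))"
  have den: "0 < K + 2 * K\<^sup>2 / m0 + 1" using K m0 by (simp add: add_nonneg_pos)
  then have \<delta>: "0 < \<delta>" by (simp add: \<delta>_def)
  have s_lim: "(s \<longlongrightarrow> 0) ?F"
    unfolding s_def using tendsto_sum[of UNIV, OF \<nu>_lim] by simp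
  have N_small: "\<forall>\<^sub>F \<gamma> in ?F. norm (N \<gamma>) < min 1 m0"
    using m0 by (intro order_tendstoD(2)[OF N_lim]) simp
  have "\<forall>\<^sub>F \<gamma> in ?F. spiked (min (1 / 2) (m0 / 2)) (real CARD('n) + K) unit_ones (s \<gamma>) (R \<gamma>)"
    using eventually_pos_params_at_infinity order_tendstoD(2)[OF s_lim \<delta>] N_small
  proof eventually_elim
    case (elim \<gamma>)
    have \<nu>: "0 < \<nu> l (\<gamma> $ l)" for l using \<nu>_pos elim by blast
    have \<nu>s: "\<nu> l (\<gamma> $ l) \<le> s \<gamma>" for l
      unfolding s_def using \<nu> by (intro member_le_sum) (auto simp: less_imp_le)
    have s: "0 < s \<gamma>" using \<nu> by (auto simp: s_def intro: sum_pos)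
    have N: "norm (N \<gamma>) \<le> 1" "norm (N \<gamma>) \<le> m0" using elim m0 by auto
    have G: "G \<gamma> = T \<gamma> + s \<gamma> *\<^sub>R N \<gamma>" using s by (simp add: N_def)
    have G_form: "u \<bullet> (G \<gamma> *v v) = (\<Sum>l\<in>UNIV. \<nu> l (\<gamma> $ l) * (u \<bullet> (D l *v v))) + s \<gamma> * (u \<bullet> (N \<gamma> *v v))"
      for u v
    proof -
      have "T \<gamma> *v v = (\<Sum>l\<in>UNIV. \<nu> l (\<gamma> $ l) *\<^sub>R (D l *v v))"
        unfolding T_def by (simp add: vec_eq_iff matrix_vector_mult_def sum_distrib_left
            sum_distrib_right mult.assoc) (auto intro: sum.swap)
      then show ?thesis
        by (simp add: G matrix_vector_mult_add_rdistrib inner_add_right inner_sum_right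
            flip: scaleR_matrix_vector_assoc)
    qed
    show ?case
    proof (rule spiked_of_perturbation[OF norm_unit_ones _ _ m0 K s, where G = "G \<gamma>"])
      show "pos_def (R \<gamma>)" using pd elim by (simp add: R_def)
      show "1 \<le> real CARD('n)" by (simp add: Suc_leI)
      show "s \<gamma> \<le> 1" using elim by (simp add: \<delta>_def)
      show "s \<gamma> * (K + 2 * K\<^sup>2 / m0) \<le> 1 / 2"
      proof -
        have "s \<gamma> * (K + 2 * K\<^sup>2 / m0 + 1) \<le> 1 / (2 * (K + 2 * K\<^sup>2 / m0 + 1)) * (K + 2 * K\<^sup>2 / m0 + 1)"
          using elim den by (intro mult_right_mono) (auto simp: \<delta>_def)
        also have "\<dots> = 1 / 2" using den by (simp add: field_simps)
        finally show ?thesis using s by (simp add: distrib_left)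
      qed
      show "v \<bullet> (R \<gamma> *v v) = real CARD('n) * (unit_ones \<bullet> v)\<^sup>2 + v \<bullet> (G \<gamma> *v v)" for v
      proof -
        have "v \<bullet> (ones_mat *v v) = (ones \<bullet> v)\<^sup>2"
          by (simp add: ones_mat_vector inner_commute power2_eq_square)
        also have "\<dots> = real CARD('n) * (unit_ones \<bullet> v)\<^sup>2"
          by (simp add: ones_eq power_mult_distrib)
        finally show ?thesis by (simp add: G_def matrix_vector_mult_diff_rdistrib inner_diff_right)
      qed
      show "\<bar>u \<bullet> (G \<gamma> *v v)\<bar> \<le> K * s \<gamma> * norm u * norm v" for u v
      proof -
        have "\<bar>\<Sum>l\<in>UNIV. \<nu> l (\<gamma> $ l) * (u \<bullet> (D l *v v))\<bar>
            \<le> (\<Sum>l\<in>UNIV. \<bar>\<nu> l (\<gamma> $ l) * (u \<bullet> (D l *v v))\<bar>)" by (rule sum_abs)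
        also have "\<dots> \<le> (\<Sum>l\<in>UNIV. s \<gamma> * (norm (D l) * norm u * norm v))"
          unfolding abs_mult using \<nu> \<nu>s s
          by (intro sum_mono mult_mono abs_bilinear_form_le) (auto simp: less_imp_le)
        also have "\<dots> = (\<Sum>l\<in>UNIV. norm (D l)) * s \<gamma> * norm u * norm v"
          by (simp add: sum_distrib_left sum_distrib_right mult_ac)
        finally have 1: "\<bar>\<Sum>l\<in>UNIV. \<nu> l (\<gamma> $ l) * (u \<bullet> (D l *v v))\<bar>
          \<le> (\<Sum>l\<in>UNIV. norm (D l)) * s \<gamma> * norm u * norm v" .
        have "\<bar>u \<bullet> (N \<gamma> *v v)\<bar> \<le> 1 * norm u * norm v"
          using abs_bilinear_form_le[of u "N \<gamma>" v] N(1)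
          by (meson mult_right_mono norm_ge_zero order_trans)
        then have 2: "\<bar>s \<gamma> * (u \<bullet> (N \<gamma> *v v))\<bar> \<le> s \<gamma> * (1 * norm u * norm v)"
          unfolding abs_mult using s by (intro mult_mono) auto
        show ?thesis unfolding G_form K_def using 1 2 by (simp add: algebra_simps)
      qed
      show "m0 * s \<gamma> * (norm v)\<^sup>2 \<le> v \<bullet> (G \<gamma> *v v)" if v: "unit_ones \<bullet> v = 0" for v
      proof -
        have "(\<Sum>l\<in>UNIV. \<nu> l (\<gamma> $ l) * (2 * m0 * (norm v)\<^sup>2)) \<le>
            (\<Sum>l\<in>UNIV. \<nu> l (\<gamma> $ l) * (v \<bullet> (D l *v v)))"
        proof (intro sum_mono mult_left_mono)
          show "2 * m0 * (norm v)\<^sup>2 \<le> v \<bullet> (D l *v v)" for l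
            using mult_right_mono[OF m0_le[of l], of "(norm v)\<^sup>2"] m(2)[OF v, of l] by simp
        qed (use \<nu> in \<open>auto simp: less_imp_le\<close>)
        then have 1: "s \<gamma> * (2 * m0 * (norm v)\<^sup>2) \<le> (\<Sum>l\<in>UNIV. \<nu> l (\<gamma> $ l) * (v \<bullet> (D l *v v)))"
          by (simp add: s_def sum_distrib_right)
        have "norm (N \<gamma>) * (norm v * norm v) \<le> m0 * (norm v * norm v)"
          using N(2) by (intro mult_right_mono) auto
        then have "- (m0 * (norm v)\<^sup>2) \<le> v \<bullet> (N \<gamma> *v v)"
          using abs_bilinear_form_le[of v "N \<gamma>" v] unfolding power2_eq_square mult.assoc by linarith
        then have 2: "s \<gamma> * - (m0 * (norm v)\<^sup>2) \<le> s \<gamma> * (v \<bullet> (N \<gamma> *v v))"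
          using s by (intro mult_left_mono) auto
        show ?thesis unfolding G_form using 1 2 by (simp add: mult_ac)
      qed
    qed
  qed
  moreover have "0 < min (1 / 2) (m0 / 2)" "0 < real CARD('n) + K"
    using m0 K by (auto intro: add_pos_nonneg)
  ultimately show ?thesis unfolding R_def s_def by blast
qed

section \<open>Tail rates of the likelihoods\<close>

text \<open>The likelihoods are only known up to a positive factor and only for positive range parameters.
  Here \<open>\<Phi>\<close> is either of the two kernels as a function of the correlation matrix.\<close>

lemma kernel_rate_bigo:
  fixes f g :: "real^'p \<Rightarrow> real" and s :: "real^'p \<Rightarrow> real"
  assumes rel: "proportional_on pos_params f g" and g: "\<And>\<gamma>. 0 \<le> g \<gamma>"
    and sp: "\<forall>\<^sub>F \<gamma> in all_params_to_infinity. spiked k C b (s \<gamma>) (R \<gamma>)"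
    and bound: "\<exists>K. \<forall>s' R'. spiked k C b s' R' \<longrightarrow> \<Phi> R' \<le> K * s' powr r"
    and g_eq: "\<And>\<gamma>. g \<gamma> = \<Phi> (R \<gamma>)"
  shows "f \<in> O[all_params_to_infinity](\<lambda>\<gamma>. s \<gamma> powr r)"
proof -
  obtain \<kappa> where \<kappa>: "0 < \<kappa>" "\<And>\<gamma>. \<gamma> \<in> pos_params \<Longrightarrow> f \<gamma> = \<kappa> * g \<gamma>"
    using rel unfolding proportional_on_def by blast
  obtain K where K: "\<And>s' R'. spiked k C b s' R' \<Longrightarrow> \<Phi> R' \<le> K * s' powr r"
    using bound by blast
  have "\<forall>\<^sub>F \<gamma> in all_params_to_infinity. norm (f \<gamma>) \<le> (\<kappa> * K) * norm (s \<gamma> powr r)"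
    using sp eventually_pos_params_at_infinity
  proof eventually_elim
    case (elim \<gamma>)
    have "norm (f \<gamma>) = \<kappa> * g \<gamma>" using \<kappa> elim g by (simp add: abs_mult)
    also have "\<dots> \<le> \<kappa> * (K * s \<gamma> powr r)"
      unfolding g_eq using \<kappa>(1) K[OF elim(1)] by (intro mult_left_mono) auto
    finally show ?case by simp
  qed
  then show ?thesis by (rule bigoI)
qed

lemma tendsto_pos_if_proportional:
  fixes f g :: "real^'p \<Rightarrow> real"
  assumes rel: "proportional_on pos_params f g"
    and g: "\<exists>r>0. (g \<longlongrightarrow> r) (one_param_to_zero l)"
  shows "\<exists>r>0. (f \<longlongrightarrow> r) (one_param_to_zero l)"
proof -
  obtain \<kappa> r where \<kappa>: "0 < \<kappa>" "\<And>\<gamma>. \<gamma> \<in> pos_params \<Longrightarrow> f \<gamma> = \<kappa> * g \<gamma>"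
    and r: "0 < r" "(g \<longlongrightarrow> r) (one_param_to_zero l)"
    using rel g unfolding proportional_on_def by blast
  have "((\<lambda>\<gamma>. \<kappa> * g \<gamma>) \<longlongrightarrow> \<kappa> * r) (one_param_to_zero l)" by (intro tendsto_intros r)
  moreover have "\<forall>\<^sub>F \<gamma> in one_param_to_zero l. \<kappa> * g \<gamma> = f \<gamma>"
    using eventually_pos_params_one_to_zero by eventually_elim (simp add: \<kappa>)
  ultimately have "(f \<longlongrightarrow> \<kappa> * r) (one_param_to_zero l)" by (rule Lim_transform_eventually)
  then show ?thesis using \<kappa>(1) r(1) by (intro exI[of _ "\<kappa> * r"]) simp
qed

theorem lemma3p3:
  fixes x :: "real ^ 'p ^ 'n"
    and h :: "'q::finite \<Rightarrow> real ^ 'p \<Rightarrow> real"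
    and H :: "real ^ 'q ^ 'n"
    and c :: "'p::finite \<Rightarrow> real \<Rightarrow> real \<Rightarrow> real"
    and R :: "real ^ 'p \<Rightarrow> real ^ 'n ^ 'n"
    and \<nu> \<omega> :: "'p \<Rightarrow> real \<Rightarrow> real"
    and D Dstar :: "'p \<Rightarrow> real ^ 'n ^ 'n"
    and B :: "'p \<Rightarrow> real \<Rightarrow> real ^ 'n ^ 'n"
    and a \<sigma>2 :: real
    and \<theta> :: "real ^ 'q"
    and \<gamma>0 :: "real ^ 'p"
    and L Lprof :: "real ^ 'n \<Rightarrow> real ^ 'p \<Rightarrow> real"
  defines "H \<equiv> basis_mat h x"
    and "R \<equiv> prod_corr_mat c x"
  assumes full_rank: "rank H = CARD('q)"
    and n_gt_q: "CARD('n) > CARD('q)"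
    and R_pos_def: "\<And>\<gamma>. \<gamma> \<in> pos_params \<Longrightarrow> pos_def (R \<gamma>)"
    and A1: "\<And>l. assumption_A1 (c l)"
    and A2: "\<And>l. assumption_A2 (corr_mat c x l) (\<nu> l) (D l) (\<omega> l) (Dstar l) (B l)"
    and a_pos: "a > 0"
    and sigma2_pos: "\<sigma>2 > 0"
    and gamma0_pos: "\<gamma>0 \<in> pos_params"
    and marginal_likelihood:
      "\<And>y. proportional_on pos_params (L y) (\<lambda>\<gamma>. marginal_kernel a (R \<gamma>) H y)"
    and profile_likelihood:
      "\<And>y. proportional_on pos_params (Lprof y) (\<lambda>\<gamma>. profile_kernel (R \<gamma>) H y)"
  shows "AE y in mvn (H *v \<theta>) (\<sigma>2 *\<^sub>R R \<gamma>0).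
      (\<forall>l. (\<exists>r>0. (L y \<longlongrightarrow> r) (one_param_to_zero l)) \<and>
           (\<exists>r>0. (Lprof y \<longlongrightarrow> r) (one_param_to_zero l))) \<and>
      (ones \<notin> column_space H \<and> (CARD('n) > CARD('q) + 1 \<or> a \<le> 1 / 2) \<longrightarrow>
         L y \<in> O[all_params_to_infinity](\<lambda>\<gamma>. (\<Sum>l\<in>UNIV. \<nu> l (\<gamma> $ l)) powr (a - 1 / 2))) \<and>
      (ones \<in> column_space H \<longrightarrow>
         L y \<in> O[all_params_to_infinity](\<lambda>\<gamma>. (\<Sum>l\<in>UNIV. \<nu> l (\<gamma> $ l)) powr (a - 1))) \<and>
      (ones \<in> column_space H \<or> CARD('n) > CARD('q) + 1 \<longrightarrow>
         Lprof y \<in> O[all_params_to_infinity](\<lambda>\<gamma>. (\<Sum>l\<in>UNIV. \<nu> l (\<gamma> $ l)) powr (1 / 2)))"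
proof -
  let ?b = "unit_ones :: real^'n"
  let ?V = "range ((*v) H)"
  let ?W = "span (insert ?b ?V)"
  note b = norm_unit_ones[where 'n='n]
  have H: "inj ((*v) H)" using full_rank by (simp add: full_rank_injective)
  have V: "subspace ?V" by (intro linear_subspace_image) auto
  have dimV: "dim ?V \<le> CARD('q)" by (rule dim_range_matrix_vector_le)
  obtain k C where k: "0 < k" and C: "0 < C" and sp: "\<forall>\<^sub>F \<gamma> in all_params_to_infinity.
      spiked k C ?b (\<Sum>l\<in>UNIV. \<nu> l (\<gamma> $ l)) (R \<gamma>)"
    using prod_corr_mat_eventually_spiked[OF R_pos_def[unfolded R_def] A1 A2] unfolding R_def by blast
  have generic: "AE y in mvn (H *v \<theta>) (\<sigma>2 *\<^sub>R R \<gamma>0).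
      y \<notin> ?V \<and> (ones \<in> column_space H \<or> CARD('n) > CARD('q) + 1 \<longrightarrow> y \<notin> ?W)"
  proof -
    have "AE y in mvn (H *v \<theta>) (\<sigma>2 *\<^sub>R R \<gamma>0). y \<notin> ?V"
      using V dimV n_gt_q by (intro AE_mvn_notin_proper_subspace) auto
    moreover have "AE y in mvn (H *v \<theta>) (\<sigma>2 *\<^sub>R R \<gamma>0).
        ones \<in> column_space H \<or> CARD('n) > CARD('q) + 1 \<longrightarrow> y \<notin> ?W"
    proof (cases "ones \<in> column_space H \<or> CARD('n) > CARD('q) + 1")
      case True
      have "dim ?W < CARD('n)"
      proof (cases "ones \<in> column_space H")
        case True
        then have "?W = ?V"
          using V by (simp add: column_space_eq_range unit_ones_in_range_iff insert_absorb span_eq_iff)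
        then show ?thesis using dimV n_gt_q by simp
      next
        case False
        then show ?thesis using True dim_insert[of ?b ?V] dimV by (auto simp: dim_span split: if_splits)
      qed
      then show ?thesis using AE_mvn_notin_proper_subspace[of ?W] by simp
    qed simp
    ultimately show ?thesis by eventually_elim simp
  qed
  show ?thesis
    using generic
  proof eventually_elim
    case (elim y)
    let ?s = "\<lambda>\<gamma>. \<Sum>l\<in>UNIV. \<nu> l (\<gamma> $ l)"
    have marg_nonneg: "0 \<le> marginal_kernel a (R \<gamma>) H y" for \<gamma> by (simp add: marginal_kernel_def)
    have prof_nonneg: "0 \<le> profile_kernel (R \<gamma>) H y" for \<gamma> by (simp add: profile_kernel_def)
    note marginal_bigo = kernel_rate_bigo[OF marginal_likelihood marg_nonneg sp _ refl]
    note profile_bigo = kernel_rate_bigo[OF profile_likelihood prof_nonneg sp _ refl]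
    have lim: "(\<exists>r>0. (L y \<longlongrightarrow> r) (one_param_to_zero l)) \<and>
           (\<exists>r>0. (Lprof y \<longlongrightarrow> r) (one_param_to_zero l))" for l
    proof -
      have Rlim: "(R \<longlongrightarrow> mat 1) (one_param_to_zero l)"
        unfolding R_def by (rule prod_corr_mat_tendsto_identity[OF A1 A2_distinct_coordinates[OF A2]])
      show ?thesis
        using likelihood_kernels_tendsto_pos[OF Rlim pos_def_mat_1 H] elim
        by (auto intro!: tendsto_pos_if_proportional[OF marginal_likelihood]
            tendsto_pos_if_proportional[OF profile_likelihood])
    qed
    have notin: "L y \<in> O[all_params_to_infinity](\<lambda>\<gamma>. ?s \<gamma> powr (a - 1 / 2))"
      if 1: "ones \<notin> column_space H" and 2: "CARD('n) > CARD('q) + 1 \<or> a \<le> 1 / 2"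
    proof (rule marginal_bigo)
      have "y \<notin> ?W \<or> (real CARD('n) - real CARD('q)) / 2 + a - 1 \<le> 0"
      proof (cases "CARD('n) > CARD('q) + 1")
        case False
        \<comment> \<open>with a single residual degree of freedom, \<open>a \<le> 1 / 2\<close> makes the exponent of \<open>S\<^sup>2\<close> nonnegative\<close>
        then have "real CARD('n) = real CARD('q) + 1" using n_gt_q by simp
        then show ?thesis using 2 False by simp
      qed (use elim in blast)
      moreover have "?b \<notin> ?V" using 1 by (simp add: column_space_eq_range unit_ones_in_range_iff)
      ultimately show "\<exists>K. \<forall>s R. spiked k C ?b s R \<longrightarrow> marginal_kernel a R H y \<le> K * s powr (a - 1 / 2)"
        using spiked_marginal_kernel_upper[OF b k C H _ spiked_gram_det_lower[OF b C H]] by simp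
    qed
    have isin: "L y \<in> O[all_params_to_infinity](\<lambda>\<gamma>. ?s \<gamma> powr (a - 1))"
      if 1: "ones \<in> column_space H"
    proof (rule marginal_bigo)
      have "(real CARD('q) - 1 - real CARD('q)) / 2 + a - 1 / 2 = a - 1" by (simp add: field_simps)
      moreover have "?b \<in> ?V" using 1 by (simp add: column_space_eq_range unit_ones_in_range_iff)
      ultimately show "\<exists>K. \<forall>s R. spiked k C ?b s R \<longrightarrow> marginal_kernel a R H y \<le> K * s powr (a - 1)"
        using spiked_marginal_kernel_upper[OF b k C H _ spiked_gram_det_lower_spike_in_range[OF b C H],
            of y a] elim 1 by simp
    qed
    have prof: "Lprof y \<in> O[all_params_to_infinity](\<lambda>\<gamma>. ?s \<gamma> powr (1 / 2))"
      if "ones \<in> column_space H \<or> CARD('n) > CARD('q) + 1"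
      by (rule profile_bigo) (rule spiked_profile_kernel_upper[OF b k C H], use elim that in blast)
    show ?case using lim notin isin prof by blast
  qed
qed

end
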